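(* Fix $d\in\mathbb{N}$ and $a>0$. Let $n=m^d$ for some $m\in\mathbb{N}$. Assume that $n$ sensors with $d$-dimensional cube sensing radius $\frac{1}{2n^{1/d}}$ are placed independently at random with the uniform distribution in the unit cube $[0,1]^d$. Then the expected $a$-total movement of algorithm $MV_d(n,1)$ (which moves the sensors to the $n$ positions $\left(\frac{l_1}{n^{1/d}}-\frac{1}{2n^{1/d}},\dots,\frac{l_d}{n^{1/d}}-\frac{1}{2n^{1/d}}\right)$, $l_1,\dots,l_d\in\{1,\dots,n^{1/d}\}$, thereby covering $[0,1]^d$) is in $O\left(n^{1-\frac{a}{2d}}\right)$ as $n\to\infty$ (the implied constant depending only on $d$ and $a$).
   Context: A sensor located at $(x_1,\dots,x_d)$ with $d$-dimensional cube sensing radius $r$ covers the axis-parallel cube with vertices $(x_1\pm r,\dots,x_d\pm r)$. If sensor $i$ is displaced a total distance $d_i$ (sum of the Euclidean lengths of its moves), the $a$-total movement is $M_a=\sum_{i=1}^n d_i^a$; the expected $a$-total movement is its expectation over the random initial placement. Algorithm $MV_d(n,y)$, for $n=m^d$ sensors in $[0,y]^d$, is defined recursively. For $d=1$: sort the sensors so that their positions satisfy $x_1\le\dots\le x_n$ and move the $i$-th sensor to $\frac{yi}{n}-\frac{y}{2n}$. For $d\ge 2$: sort the sensors by their first coordinate, $S_1,\dots,S_n$ with nondecreasing first coordinates; for $j=1,\dots,n^{1/d}$, the sensors $S_i$ with $(j-1)n^{(d-1)/d}<i\le jn^{(d-1)/d}$ form block $j$, and each of them has its first coordinate changed to $\frac{jy}{n^{1/d}}-\frac{y}{2n^{1/d}}$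 (other coordinates unchanged); then for each block $j$, algorithm $MV_{d-1}(n^{(d-1)/d},y)$ is executed on the remaining $d-1$ coordinates of the sensors of block $j$. *)

theory Defs
  imports "HOL-Probability.Probability" "HOL-Library.Landau_Symbols"
begin

text \<open>
  Sensors are natural numbers. A point of \<open>d\<close>-dimensional space is a function on the coordinates
  \<open>0, \<dots>, d - 1\<close>, so that the dimension can change along the recursion of the algorithm. The state of
  a run consists of the current positions of all sensors and the total distance each sensor has
  travelled so far.
\<close>

type_synonym point = "nat \<Rightarrow> real"
type_synonym state = "(nat \<Rightarrow> point) \<times> (nat \<Rightarrow> real)"

definition euclid_dist :: "nat \<Rightarrow> point \<Rightarrow> point \<Rightarrow> real" where
  "euclid_dist d p q = L2_set (\<lambda>k. p k - q k) {..<d}"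

definition move_to :: "nat \<Rightarrow> nat \<Rightarrow> point \<Rightarrow> state \<Rightarrow> state" where
  "move_to d i q st =
     ((fst st)(i := q), (snd st)(i := snd st i + euclid_dist d (fst st i) q))"

definition move_coord :: "nat \<Rightarrow> nat \<Rightarrow> nat \<Rightarrow> real \<Rightarrow> state \<Rightarrow> state" where
  "move_coord d k i v st = move_to d i ((fst st i)(k := v)) st"

text \<open>Ties are broken by the order of the input list, since \<^const>\<open>sort_key\<close> is stable.\<close>

definition sort_sensors :: "nat \<Rightarrow> state \<Rightarrow> nat list \<Rightarrow> nat list" where
  "sort_sensors k st S = sort_key (\<lambda>i. fst st i k) S"

definition block :: "nat \<Rightarrow> nat \<Rightarrow> 'a list \<Rightarrow> 'a list" where
  "block b j T = take b (drop ((j - 1) * b) T)"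

definition anchor :: "nat \<Rightarrow> real \<Rightarrow> nat \<Rightarrow> real" where
  "anchor m y j = real j * y / real m - y / (2 * real m)"

text \<open>
  \<open>MV_on d m y r S\<close> is the algorithm in dimension \<open>r\<close> for the \<open>m ^ r\<close> sensors listed in \<open>S\<close>, executed on
  the last \<open>r\<close> of the \<open>d\<close> coordinates; the first of these has index \<open>d - r\<close>. The parameter \<open>m\<close> is the
  \<open>r\<close>-th root of the number of sensors; it is the same at all levels of the recursion. Blocks have
  \<open>m ^ (r - 1)\<close> elements, and the lists are indexed from \<open>0\<close>.
\<close>

fun MV_on :: "nat \<Rightarrow> nat \<Rightarrow> real \<Rightarrow> nat \<Rightarrow> nat list \<Rightarrow> state \<Rightarrow> state" where
  "MV_on d m y 0 S st = st"
| "MV_on d m y (Suc 0) S st =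
     (let T = sort_sensors (d - 1) st S
      in fold (\<lambda>i. move_coord d (d - 1) (T ! (i - 1)) (anchor m y i)) [1..<Suc m] st)"
| "MV_on d m y (Suc (Suc r)) S st =
     (let k = d - Suc (Suc r);
          T = sort_sensors k st S;
          B = (\<lambda>j. block (m ^ Suc r) j T);
          st' = fold (\<lambda>j. fold (\<lambda>i. move_coord d k i (anchor m y j)) (B j)) [1..<Suc m] st
      in fold (\<lambda>j st. MV_on d m y (Suc r) (B j) st) [1..<Suc m] st')"

text \<open>\<open>MV d m y x\<close> runs the algorithm for \<open>n = m ^ d\<close> sensors from the initial placement \<open>x\<close>.\<close>

definition MV :: "nat \<Rightarrow> nat \<Rightarrow> real \<Rightarrow> (nat \<Rightarrow> point) \<Rightarrow> state" where
  "MV d m y x = MV_on d m y d [0..<m ^ d] (x, \<lambda>_. 0)"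

definition final_position :: "nat \<Rightarrow> nat \<Rightarrow> real \<Rightarrow> (nat \<Rightarrow> point) \<Rightarrow> nat \<Rightarrow> point" where
  "final_position d m y x i = fst (MV d m y x) i"

definition displacement :: "nat \<Rightarrow> nat \<Rightarrow> real \<Rightarrow> (nat \<Rightarrow> point) \<Rightarrow> nat \<Rightarrow> real" where
  "displacement d m y x i = snd (MV d m y x) i"

definition total_movement :: "real \<Rightarrow> nat \<Rightarrow> nat \<Rightarrow> real \<Rightarrow> (nat \<Rightarrow> point) \<Rightarrow> real" where
  "total_movement a d m y x = (\<Sum>i<m ^ d. displacement d m y x i powr a)"

definition unit_cube :: "nat \<Rightarrow> point set" where
  "unit_cube d = (\<Pi>\<^sub>E k\<in>{..<d}. {0..1})"

definition sensing_cube :: "nat \<Rightarrow> real \<Rightarrow> point \<Rightarrow> point set" where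
  "sensing_cube d r p = (\<Pi>\<^sub>E k\<in>{..<d}. {p k - r..p k + r})"

definition grid :: "nat \<Rightarrow> nat \<Rightarrow> point set" where
  "grid d m = (\<Pi>\<^sub>E k\<in>{..<d}. {real l / real m - 1 / (2 * real m) | l. l \<in> {1..m}})"

definition uniform_cube :: "nat \<Rightarrow> point measure" where
  "uniform_cube d = uniform_measure (\<Pi>\<^sub>M k\<in>{..<d}. lborel) (unit_cube d)"

definition random_placement :: "nat \<Rightarrow> nat \<Rightarrow> (nat \<Rightarrow> point) measure" where
  "random_placement d n = (\<Pi>\<^sub>M i\<in>{..<n}. uniform_cube d)"

end

theory Submission
  imports Defs "HOL-Real_Asymp.Real_Asymp"
begin

text \<open>
  When the algorithm treats coordinate \<open>k\<close>, the blocks were chosen by looking at the earlier coordinates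
  only, so within a block of \<open>N = m ^ (d - k)\<close> sensors the \<open>k\<close>-th coordinates are still independent and
  uniform. The sensor of rank \<open>t\<close> travels from the \<open>t\<close>-th order statistic to an anchor that is within
  \<open>O(1 / m)\<close> of \<open>t / N\<close>. By Hoeffding's inequality the order statistic deviates from the anchor by more
  than \<open>s \<ge> 1 / m\<close> with probability at most \<open>2 exp (- N s\<^sup>2 / 2)\<close>; as \<open>N \<ge> m\<close>, summing over the shells
  \<open>l < sqrt m * deviation \<le> l + 1\<close> bounds the expected \<open>a\<close>-th power of every single move by
  \<open>O(m powr (- a / 2))\<close>. There are \<open>m ^ d\<close> sensors with \<open>d\<close> moves each, and
  \<open>m ^ d * m powr (- a / 2) = n powr (1 - a / (2 * d))\<close>.
\<close>

subsection \<open>Blocks and target indices\<close>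

text \<open>The prefix cut off by \<open>takeWhile\<close> consists of the entries before
  \<open>i\<close>, so its length is the rank of \<open>i\<close> counted from 0. Blocks are
  numbered from 1, as in \<open>block\<close> and \<open>anchor\<close>, hence the
  \<open>Suc\<close>.\<close>

definition block_index :: "nat \<Rightarrow> 'a list \<Rightarrow> 'a \<Rightarrow> nat" where
  "block_index b T i = Suc (length (takeWhile (\<lambda>j. j \<noteq> i) T) div b)"

lemma block_index_nth:
  assumes "distinct T" "t < length T"
  shows "block_index b T (T ! t) = Suc (t div b)"
proof -
  have "takeWhile (\<lambda>j. j \<noteq> T ! t) T = take t T"
    by (rule takeWhile_eq_take_P_nth) (use assms in \<open>auto simp: nth_eq_iff_index_eq\<close>)
  with assms show ?thesis by (simp add: block_index_def)
qed

lemma block_index_in_range: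
  assumes "distinct T" "length T = m * b" "i \<in> set T"
  shows "block_index b T i \<in> {1..m}"
proof -
  obtain t where t: "t < length T" "i = T ! t"
    using assms(3) by (auto simp: in_set_conv_nth)
  then have "t div b < m"
    using assms(2) by (simp add: less_mult_imp_div_less)
  then show ?thesis
    using t assms(1) by (simp add: block_index_nth)
qed

text \<open>Block \<open>j\<close> occupies the positions \<open>t\<close> with
  \<open>t div b = j - 1\<close>. Hence the blocks are the fibres of \<open>block_index\<close>,
  which yields their disjointness and the grouping of sums by blocks.\<close>

lemma in_set_block_iff:
  assumes "distinct T" "b > 0" "j \<ge> 1"
  shows "i \<in> set (block b j T) \<longleftrightarrow> i \<in> set T \<and> block_index b T i = j"
proof -
  have "i \<in> set (block b j T) \<longleftrightarrow> (\<exists>t<length T. (j - 1) * b \<le> t \<and> t < (j - 1) * b + b \<and> i = T ! t)"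
  proof
    assume "i \<in> set (block b j T)"
    then obtain s where "s < b" "s < length T - (j - 1) * b" "i = T ! ((j - 1) * b + s)"
      by (auto simp: block_def in_set_conv_nth)
    then show "\<exists>t<length T. (j - 1) * b \<le> t \<and> t < (j - 1) * b + b \<and> i = T ! t"
      by (intro exI[of _ "(j - 1) * b + s"]) auto
  next
    assume "\<exists>t<length T. (j - 1) * b \<le> t \<and> t < (j - 1) * b + b \<and> i = T ! t"
    then obtain t where t: "t < length T" "(j - 1) * b \<le> t" "t < (j - 1) * b + b" "i = T ! t"
      by blast
    then show "i \<in> set (block b j T)"
      unfolding block_def in_set_conv_nth by (intro exI[of _ "t - (j - 1) * b"]) auto
  qed
  also have "\<dots> \<longleftrightarrow> (\<exists>t<length T. Suc (t div b) = j \<and> i = T ! t)"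
  proof -
    have "(j - 1) * b \<le> t \<and> t < (j - 1) * b + b \<longleftrightarrow> Suc (t div b) = j" for t
    proof -
      have "Suc (t div b) = j \<longleftrightarrow> j - 1 \<le> t div b \<and> t div b < j"
        using assms(3) by linarith
      also have "\<dots> \<longleftrightarrow> (j - 1) * b \<le> t \<and> t < j * b"
        using assms(2) by (simp add: less_eq_div_iff_mult_less_eq div_less_iff_less_mult)
      also have "j * b = (j - 1) * b + b"
        using assms(3) by (cases j) auto
      finally show ?thesis by blast
    qed
    then show ?thesis by blast
  qed
  also have "\<dots> \<longleftrightarrow> i \<in> set T \<and> block_index b T i = j"
    using assms(1) by (auto simp: in_set_conv_nth block_index_nth)
  finally show ?thesis .
qed

lemma length_block:
  assumes "length T = m * b" "j \<in> {1..m}"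
  shows "length (block b j T) = b"
proof -
  have "(j - 1) * b + b \<le> m * b"
    using assms(2) mult_le_mono1[of j m b] by (cases j) auto
  then show ?thesis by (simp add: block_def assms(1))
qed

lemma distinct_block: "distinct T \<Longrightarrow> distinct (block b j T)"
  by (simp add: block_def)

text \<open>Sensor \<open>i\<close> is moved to the \<open>target\<close>-th anchor on axis \<open>l\<close>. Only initial positions \<open>x\<close> enter, since
  no coordinate changes before the algorithm sorts by it. The case \<open>r = 0\<close> is a dummy value.\<close>

fun target :: "nat \<Rightarrow> nat \<Rightarrow> (nat \<Rightarrow> point) \<Rightarrow> nat \<Rightarrow> nat list \<Rightarrow> nat \<Rightarrow> nat \<Rightarrow> nat" where
  "target d m x 0 S i l = 0"
| "target d m x (Suc r) S i l =
     (let T = sort_key (\<lambda>i. x i (d - Suc r)) S; j = block_index (m ^ r) T i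
      in if l = d - Suc r then j else target d m x r (block (m ^ r) j T) i l)"

lemma insort_key_cong:
  "(\<And>i. i \<in> insert a (set T) \<Longrightarrow> f i = g i) \<Longrightarrow> insort_key f a T = insort_key g a T"
  by (induction T) auto

lemma sort_key_cong:
  "(\<And>i. i \<in> set S \<Longrightarrow> f i = g i) \<Longrightarrow> sort_key f S = sort_key g S"
proof (induction S)
  case (Cons a S)
  then have "sort_key f S = sort_key g S" by simp
  then show ?case using Cons.prems by (auto intro!: insort_key_cong)
qed simp

lemma set_block_subset: "set (block b j T) \<subseteq> set T"
  unfolding block_def by (meson set_take_subset set_drop_subset subset_trans)

text \<open>At level \<open>r\<close> the recursion sorts by coordinate \<open>d - r\<close> and
  afterwards looks only at later coordinates, and only at sensors in \<open>S\<close>. This locality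
  separates the treatment of one coordinate from that of the others, both in the run and in the
  expectation.\<close>

lemma target_cong:
  assumes "r \<le> d" "\<And>i l. i \<in> set S \<Longrightarrow> d - r \<le> l \<Longrightarrow> l < d \<Longrightarrow> x i l = x' i l"
  shows "target d m x r S i l = target d m x' r S i l"
  using assms
proof (induction r arbitrary: S)
  case (Suc r)
  have T: "sort_key (\<lambda>i. x i (d - Suc r)) S = sort_key (\<lambda>i. x' i (d - Suc r)) S" (is "?T = ?T'")
    using Suc.prems by (intro sort_key_cong) auto
  have "target d m x r (block (m ^ r) j ?T) i l = target d m x' r (block (m ^ r) j ?T) i l" for j
  proof (rule Suc.IH)
    show "r \<le> d" using Suc.prems by simp
    fix i l assume "i \<in> set (block (m ^ r) j ?T)" "d - r \<le> l" "l < d"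
    then show "x i l = x' i l"
      using set_block_subset[of "m ^ r" j ?T] Suc.prems by auto
  qed
  then show ?case by (simp add: T Let_def)
qed simp

lemma target_in_range:
  assumes "r \<le> d" "distinct S" "length S = m ^ r" "i \<in> set S" "d - r \<le> l" "l < d"
  shows "target d m x r S i l \<in> {1..m}"
  using assms
proof (induction r arbitrary: S)
  case (Suc r)
  define T where "T = sort_key (\<lambda>i. x i (d - Suc r)) S"
  define j where "j = block_index (m ^ r) T i"
  have T: "distinct T" "length T = m * m ^ r" "i \<in> set T"
    using Suc.prems by (auto simp: T_def)
  have j: "j \<in> {1..m}" unfolding j_def by (rule block_index_in_range[OF T])
  show ?case
  proof (cases "l = d - Suc r")
    case True
    then show ?thesis using j by (auto simp: T_def j_def Let_def)
  next
    case False
    have "target d m x r (block (m ^ r) j T) i l \<in> {1..m}"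
    proof (rule Suc.IH)
      have "m ^ r > 0" using j by auto
      then show "i \<in> set (block (m ^ r) j T)"
        using T j by (subst in_set_block_iff) (auto simp: j_def)
    qed (use Suc.prems False T j in \<open>auto simp: distinct_block length_block\<close>)
    then show ?thesis using False by (simp add: T_def j_def Let_def)
  qed
qed simp

text \<open>The first target decides the block, so equal targets put both sensors into the same
  block, where the remaining targets separate them by induction. A list of length
  \<open>m ^ 0\<close> has a single entry.\<close>

lemma target_inj:
  assumes "r \<le> d" "m \<ge> 1" "distinct S" "length S = m ^ r" "i \<in> set S" "i' \<in> set S"
    and "\<And>l. d - r \<le> l \<Longrightarrow> l < d \<Longrightarrow> target d m x r S i l = target d m x r S i' l"
  shows "i = i'"
  using assms
proof (induction r arbitrary: S)
  case 0
  then show ?case by (auto simp: length_Suc_conv)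
next
  case (Suc r)
  define T where "T = sort_key (\<lambda>i. x i (d - Suc r)) S"
  define j where "j = block_index (m ^ r) T i"
  have T: "distinct T" "length T = m * m ^ r" "i \<in> set T" "i' \<in> set T"
    using Suc.prems by (auto simp: T_def)
  have tgt: "target d m x (Suc r) S v l =
      (if l = d - Suc r then block_index (m ^ r) T v
       else target d m x r (block (m ^ r) (block_index (m ^ r) T v) T) v l)" for v l
    by (simp add: T_def Let_def)
  have j': "block_index (m ^ r) T i' = j"
    using Suc.prems(7)[of "d - Suc r"] Suc.prems(1) unfolding tgt by (auto simp: j_def)
  have j: "j \<in> {1..m}" unfolding j_def by (rule block_index_in_range[OF T(1-3)])
  show ?case
  proof (rule Suc.IH)
    show "i \<in> set (block (m ^ r) j T)" "i' \<in> set (block (m ^ r) j T)"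
      using T j j' Suc.prems(2) by (auto simp: in_set_block_iff j_def)
    show "target d m x r (block (m ^ r) j T) i l = target d m x r (block (m ^ r) j T) i' l"
      if "d - r \<le> l" "l < d" for l
    proof -
      have "d - Suc r \<le> l" "l \<noteq> d - Suc r"
        using that Suc.prems(1) by auto
      then show ?thesis
        using Suc.prems(7)[of l] that(2) j' unfolding tgt by (simp add: j_def)
    qed
  qed (use Suc.prems T j in \<open>auto simp: distinct_block length_block\<close>)
qed

subsection \<open>Explicit form of a run\<close>

text \<open>Position and travelled distance are kept together so that runs can be compared sensor by
  sensor.\<close>

definition sensor :: "state \<Rightarrow> nat \<Rightarrow> point \<times> real" where
  "sensor st i = (fst st i, snd st i)"

lemma sensor_fold_outside:
  assumes "\<And>j st i. j \<in> set js \<Longrightarrow> i \<notin> A j \<Longrightarrow> sensor (F j st) i = sensor st i"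
    and "\<forall>j\<in>set js. i \<notin> A j"
  shows "sensor (fold F js st) i = sensor st i"
  using assms by (induction js arbitrary: st) auto

text \<open>Step \<open>j\<close> changes only sensors in \<open>A j\<close>, and its effect there
  depends only on the state of these sensors. As the sets \<open>A j\<close> are disjoint, the steps
  before \<open>j\<close> leave its input intact and those after it leave its result intact.\<close>

lemma sensor_fold_inside:
  assumes "\<And>j st i. j \<in> set js \<Longrightarrow> i \<notin> A j \<Longrightarrow> sensor (F j st) i = sensor st i"
    and "\<And>j st st' i. j \<in> set js \<Longrightarrow> i \<in> A j \<Longrightarrow> \<forall>i\<in>A j. sensor st i = sensor st' i \<Longrightarrow>
           sensor (F j st) i = sensor (F j st') i"
    and "disjoint_family_on A (set js)" "distinct js" "j \<in> set js" "i \<in> A j"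
  shows "sensor (fold F js st) i = sensor (F j st) i"
  using assms
proof (induction js arbitrary: st)
  case (Cons a js)
  show ?case
  proof (cases "j = a")
    case True
    have "\<forall>j'\<in>set js. i \<notin> A j'"
      using Cons.prems(3-6) True by (auto simp: disjoint_family_on_def)
    then have "sensor (fold F js (F a st)) i = sensor (F a st) i"
      using Cons.prems(1) by (intro sensor_fold_outside) auto
    with True show ?thesis by simp
  next
    case False
    then have j: "j \<in> set js" using Cons.prems(5) by simp
    have "sensor (fold F js (F a st)) i = sensor (F j (F a st)) i"
      by (rule Cons.IH[OF Cons.prems(1) Cons.prems(2)])
        (use Cons.prems(3,4,6) j in \<open>auto simp: disjoint_family_on_def\<close>)
    also have "\<dots> = sensor (F j st) i"
    proof (rule Cons.prems(2))
      have "A j \<inter> A a = {}"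
        using Cons.prems(3,5) False by (auto simp: disjoint_family_on_def)
      then show "\<forall>i\<in>A j. sensor (F a st) i = sensor st i"
        using Cons.prems(1)[of a _ st] by (auto simp del: prod.inject)
    qed (use j Cons.prems(6) in auto)
    finally show ?thesis by simp
  qed
qed simp

text \<open>For an axis-parallel move all terms of the Euclidean norm but one vanish, so its length
  is an absolute difference.\<close>

lemma sensor_move_coord:
  assumes "k < d"
  shows "sensor (move_coord d k i v st) i' =
    (if i' = i then ((fst st i)(k := v), snd st i + \<bar>fst st i k - v\<bar>) else sensor st i')"
proof -
  have "euclid_dist d (fst st i) ((fst st i)(k := v)) = L2_set (\<lambda>l. if l = k then fst st i k - v else 0) {..<d}"
    unfolding euclid_dist_def by (intro L2_set_cong) auto
  also have "\<dots> = \<bar>fst st i k - v\<bar>"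
    using assms by (simp add: L2_set_def if_distrib[of "\<lambda>x. x\<^sup>2"] sum.delta' cong: if_cong)
  finally show ?thesis by (simp add: move_coord_def move_to_def sensor_def)
qed

lemma sensor_move_coords:
  assumes "k < d" "distinct B"
  shows "sensor (fold (\<lambda>i. move_coord d k i v) B st) i =
    (if i \<in> set B then ((fst st i)(k := v), snd st i + \<bar>fst st i k - v\<bar>) else sensor st i)"
proof (cases "i \<in> set B")
  case True
  have "sensor (fold (\<lambda>i. move_coord d k i v) B st) i = sensor (move_coord d k i v st) i"
    by (rule sensor_fold_inside[where A = "\<lambda>i. {i}"])
      (use assms True in \<open>auto simp: sensor_move_coord disjoint_family_on_def, auto simp: sensor_def\<close>)
  then show ?thesis using True assms(1) by (simp add: sensor_move_coord)
next
  case False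
  then show ?thesis
    by (subst sensor_fold_outside[where A = "\<lambda>i. {i}"]) (use assms in \<open>auto simp: sensor_move_coord\<close>)
qed

text \<open>The recursive equation of \<open>MV_on\<close> with \<open>r\<close> for
  \<open>Suc r\<close>, which makes sense for \<open>r = 0\<close> too.\<close>

definition MV_step where
  "MV_step d m y r S st =
     (let k = d - Suc r;
          T = sort_sensors k st S;
          B = (\<lambda>j. block (m ^ r) j T);
          st' = fold (\<lambda>j. fold (\<lambda>i. move_coord d k i (anchor m y j)) (B j)) [1..<Suc m] st
      in fold (\<lambda>j st. MV_on d m y r (B j) st) [1..<Suc m] st')"

text \<open>With blocks of size one, the base case \<open>d = 1\<close> is an instance of the recursive case.\<close>

lemma MV_on_Suc:
  assumes "length S = m ^ Suc r"
  shows "MV_on d m y (Suc r) S st = MV_step d m y r S st"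
proof (cases r)
  case 0
  define T where "T = sort_sensors (d - 1) st S"
  have "block 1 j T = [T ! (j - 1)]" if "j \<in> set [1..<Suc m]" for j
  proof -
    have "j - 1 < length T" using that assms 0 by (auto simp: T_def sort_sensors_def)
    then show ?thesis by (simp add: block_def Cons_nth_drop_Suc[symmetric])
  qed
  then have "fold (\<lambda>j. fold (\<lambda>i. move_coord d (d - 1) i (anchor m y j)) (block 1 j T)) [1..<Suc m] st
    = fold (\<lambda>i. move_coord d (d - 1) (T ! (i - 1)) (anchor m y i)) [1..<Suc m] st"
    by (intro fold_cong) auto
  \<comment> \<open>For \<open>r = 0\<close> the recursive calls leave the state unchanged.\<close>
  moreover have "fold (\<lambda>j (st::state). st) js st = st" for js :: "nat list" and st
    by (induction js) auto
  ultimately show ?thesis by (simp add: 0 MV_step_def T_def Let_def del: upt_Suc)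
qed (simp add: MV_step_def)

text \<open>Both loops act on disjoint blocks, so a sensor is affected only by the pass over its own
  block (\<open>sensor_fold_inside\<close>). Moving coordinate \<open>k\<close> does not disturb
  later targets, which by \<open>target_cong\<close> read coordinates above \<open>k\<close> only;
  hence all targets can be computed from the state at the start.\<close>

lemma sensor_MV_on:
  assumes "r \<le> d" "m \<ge> 1" "distinct S" "length S = m ^ r"
  shows "sensor (MV_on d m y r S st) i =
    (if i \<in> set S then
       (\<lambda>l. if d - r \<le> l \<and> l < d then anchor m y (target d m (fst st) r S i l) else fst st i l,
        snd st i + (\<Sum>l = d - r..<d. \<bar>fst st i l - anchor m y (target d m (fst st) r S i l)\<bar>))
     else sensor st i)"
  using assms
proof (induction r arbitrary: S st i)
  case 0
  then show ?case by (auto simp: sensor_def)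
next
  case (Suc r)
  define k where "k = d - Suc r"
  have k: "k < d" "d - r = Suc k" using Suc.prems(1) by (auto simp: k_def)
  define T where "T = sort_sensors k st S"
  define B where "B = (\<lambda>j. block (m ^ r) j T)"
  have T: "distinct T" "length T = m * m ^ r" "set T = set S"
    using Suc.prems by (auto simp: T_def sort_sensors_def)
  have B: "distinct (B j)" "length (B j) = m ^ r" if "j \<in> {1..m}" for j
    using T that by (auto simp: B_def distinct_block length_block)
  have B_iff: "v \<in> set (B j) \<longleftrightarrow> v \<in> set S \<and> block_index (m ^ r) T v = j" if "j \<in> {1..m}" for v j
    using that T Suc.prems(2) by (auto simp: B_def in_set_block_iff)
  have disj: "disjoint_family_on (\<lambda>j. set (B j)) (set [1..<Suc m])"
    unfolding disjoint_family_on_def by (auto simp del: upt_Suc simp: B_iff)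
  define move where "move = (\<lambda>j. fold (\<lambda>i. move_coord d k i (anchor m y j)) (B j))"
  have sensor_move: "sensor (move j st) i =
    (if i \<in> set (B j) then ((fst st i)(k := anchor m y j), snd st i + \<bar>fst st i k - anchor m y j\<bar>)
     else sensor st i)" if "j \<in> set [1..<Suc m]" for j st i
    unfolding move_def using that B by (intro sensor_move_coords[OF k(1)]) auto
  define st' where "st' = fold move [1..<Suc m] st"
  have run: "MV_on d m y (Suc r) S st = fold (\<lambda>j. MV_on d m y r (B j)) [1..<Suc m] st'"
    using Suc.prems(4)
    by (simp add: MV_on_Suc MV_step_def Let_def st'_def B_def T_def k_def move_def del: upt_Suc MV_on.simps)
  have IH: "sensor (MV_on d m y r (B j) st) i =
    (if i \<in> set (B j) then
       (\<lambda>l. if Suc k \<le> l \<and> l < d then anchor m y (target d m (fst st) r (B j) i l) else fst st i l,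
        snd st i + (\<Sum>l = Suc k..<d. \<bar>fst st i l - anchor m y (target d m (fst st) r (B j) i l)\<bar>))
     else sensor st i)" if "j \<in> set [1..<Suc m]" for j st i
    using that Suc.prems(1,2) B[of j] by (subst Suc.IH) (auto simp: k(2))
  show ?case
  proof (cases "i \<in> set S")
    case False
    then have "\<forall>j\<in>set [1..<Suc m]. i \<notin> set (B j)"
      by (auto simp: B_iff)
    moreover from this have "sensor st' i = sensor st i"
      unfolding st'_def
      by (intro sensor_fold_outside[where A = "\<lambda>j. set (B j)"]) (auto simp: sensor_move simp del: upt_Suc)
    ultimately have "sensor (MV_on d m y (Suc r) S st) i = sensor st i"
      unfolding run
      by (subst sensor_fold_outside[where A = "\<lambda>j. set (B j)"]) (auto simp: IH simp del: upt_Suc)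
    then show ?thesis using False by simp
  next
    case True
    define j where "j = block_index (m ^ r) T i"
    have j: "j \<in> set [1..<Suc m]" and iB: "i \<in> set (B j)"
      using block_index_in_range[OF T(1,2), of i] True T B_iff[of j i] by (auto simp: j_def)
    have st': "sensor st' v = ((fst st v)(k := anchor m y j), snd st v + \<bar>fst st v k - anchor m y j\<bar>)"
      if "v \<in> set (B j)" for v
    proof -
      have "sensor st' v = sensor (move j st) v"
        unfolding st'_def
        by (rule sensor_fold_inside[where A = "\<lambda>j. set (B j)"])
          (use disj j that in \<open>auto simp: sensor_move simp del: upt_Suc, auto simp: sensor_def\<close>)
      then show ?thesis using that j by (simp add: sensor_move)
    qed
    have "sensor (MV_on d m y (Suc r) S st) i = sensor (MV_on d m y r (B j) st') i"
      unfolding run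
    proof (rule sensor_fold_inside[where A = "\<lambda>j. set (B j)"])
      fix j st st' i
      assume j: "j \<in> set [1..<Suc m]" and i: "i \<in> set (B j)"
        and eq: "\<forall>i\<in>set (B j). sensor st i = sensor st' i"
      \<comment> \<open>Both states agree on the block, hence so do the targets: a call reads
        nothing outside its block.\<close>
      have "target d m (fst st) r (B j) i l = target d m (fst st') r (B j) i l" for l
        using Suc.prems(1) eq by (intro target_cong) (auto simp: sensor_def)
      then show "sensor (MV_on d m y r (B j) st) i = sensor (MV_on d m y r (B j) st') i"
        using eq i unfolding IH[OF j] by (auto simp: sensor_def fun_eq_iff intro!: sum.cong)
    qed (use disj j iB in \<open>auto simp: IH simp del: upt_Suc\<close>)
    also have "\<dots> = (\<lambda>l. if k \<le> l \<and> l < d then anchor m y (target d m (fst st) (Suc r) S i l) else fst st i l,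
        snd st i + (\<Sum>l = k..<d. \<bar>fst st i l - anchor m y (target d m (fst st) (Suc r) S i l)\<bar>))"
    proof -
      have T_eq: "T = sort_key (\<lambda>i. fst st i (d - Suc r)) S"
        by (simp add: T_def sort_sensors_def k_def)
      have tgt: "target d m (fst st) (Suc r) S i l =
          (if l = k then j else target d m (fst st) r (B j) i l)" for l
        by (simp add: T_eq[symmetric] Let_def k_def j_def B_def)
      \<comment> \<open>On this block \<open>st'\<close> differs from \<open>st\<close> in
        coordinate \<open>k\<close> and in the distances travelled, neither of which enters the
        targets for later coordinates.\<close>
      have tgt': "target d m (fst st') r (B j) i l = target d m (fst st) r (B j) i l" for l
        using Suc.prems(1) st' k by (intro target_cong) (auto simp: sensor_def)
      have "fst st' i = (fst st i)(k := anchor m y j)" "snd st' i = snd st i + \<bar>fst st i k - anchor m y j\<bar>"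
        using st'[OF iB] by (auto simp: sensor_def)
      then show ?thesis
        unfolding IH[OF j] using iB k(1)
        by (auto simp: tgt tgt' fun_eq_iff sum.atLeast_Suc_lessThan simp del: target.simps intro!: sum.cong)
    qed
    finally show ?thesis using True by (simp add: k_def)
  qed
qed

lemma displacement_eq:
  assumes "m \<ge> 1" "i < m ^ d"
  shows "displacement d m y x i = (\<Sum>l<d. \<bar>x i l - anchor m y (target d m x d [0..<m ^ d] i l)\<bar>)"
  using sensor_MV_on[of d d m "[0..<m ^ d]" y "(x, \<lambda>_. 0)" i] assms
  by (simp add: displacement_def MV_def sensor_def atLeast0LessThan)

lemma final_position_eq:
  assumes "m \<ge> 1" "i < m ^ d"
  shows "final_position d m y x i =
    (\<lambda>l. if l < d then anchor m y (target d m x d [0..<m ^ d] i l) else x i l)"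
  using sensor_MV_on[of d d m "[0..<m ^ d]" y "(x, \<lambda>_. 0)" i] assms
  by (simp add: final_position_def MV_def sensor_def fun_eq_iff)

section \<open>Anchors, the grid and the covering of the cube\<close>

lemma anchor_1: "anchor m 1 j = real j / real m - 1 / (2 * real m)"
  by (simp add: anchor_def)

lemma anchor_1_eq_iff: "m \<ge> 1 \<Longrightarrow> anchor m 1 j = anchor m 1 j' \<longleftrightarrow> j = j'"
  by (simp add: anchor_1 field_simps)

lemma grid_eq: "grid d m = (\<Pi>\<^sub>E k\<in>{..<d}. anchor m 1 ` {1..m})"
proof -
  have "{real l / real m - 1 / (2 * real m) | l. l \<in> {1..m}} = anchor m 1 ` {1..m}"
    by (auto simp: anchor_1)
  then show ?thesis by (simp add: grid_def)
qed

lemma card_grid: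
  assumes "m \<ge> 1" shows "card (grid d m) = m ^ d"
proof -
  have "inj_on (anchor m 1) {1..m}"
    using assms by (simp add: inj_on_def anchor_1_eq_iff)
  then show ?thesis unfolding grid_eq by (simp add: card_PiE card_image)
qed

lemma finite_grid: "finite (grid d m)"
  unfolding grid_eq by (intro finite_PiE) auto

text \<open>Injectivity comes from \<open>target_inj\<close>, since distinct targets give distinct
  anchors; sensors and grid points are equally many, so the image is the whole grid.\<close>

lemma bij_betw_final_position:
  assumes "m \<ge> 1" "x \<in> (\<Pi>\<^sub>E i\<in>{..<m ^ d}. unit_cube d)"
  shows "bij_betw (final_position d m 1 x) {..<m ^ d} (grid d m)"
proof -
  let ?t = "target d m x d [0..<m ^ d]"
  have inj: "inj_on (final_position d m 1 x) {..<m ^ d}"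
  proof (rule inj_onI)
    fix i i' assume ii: "i \<in> {..<m ^ d}" "i' \<in> {..<m ^ d}"
      and eq: "final_position d m 1 x i = final_position d m 1 x i'"
    have "?t i l = ?t i' l" if "l < d" for l
      using fun_cong[OF eq, of l] that ii assms(1)
      by (simp add: final_position_eq anchor_1_eq_iff)
    then show "i = i'"
      using target_inj[of d d m "[0..<m ^ d]" i i' x] assms(1) ii by auto
  qed
  have sub: "final_position d m 1 x ` {..<m ^ d} \<subseteq> grid d m"
  proof safe
    fix i assume i: "i < m ^ d"
    \<comment> \<open>Grid points are \<open>undefined\<close> outside \<open>{..<d}\<close>. The
      run does not touch these coordinates, so the initial position has to supply this
      value.\<close>
    have "x i \<in> unit_cube d" using assms(2) i by blast
    then have ext: "x i l = undefined" if "\<not> l < d" for l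
      using that PiE_arb[of "x i" "{..<d}" "\<lambda>_. {0..1}" l] by (simp add: unit_cube_def)
    have "?t i l \<in> {1..m}" if "l < d" for l
      using target_in_range[of d d "[0..<m ^ d]" m i l x] that i by simp
    then show "final_position d m 1 x i \<in> grid d m"
      unfolding final_position_eq[OF assms(1) i] grid_eq using ext by (intro PiE_I) simp_all
  qed
  have "card (final_position d m 1 x ` {..<m ^ d}) = card (grid d m)"
    using inj by (simp add: card_image card_grid[OF assms(1)])
  then have "final_position d m 1 x ` {..<m ^ d} = grid d m"
    using sub finite_grid by (metis card_subset_eq)
  with inj show ?thesis by (simp add: bij_betw_def)
qed

lemma unit_cube_covered_by_grid:
  assumes "m \<ge> 1"
  shows "unit_cube d \<subseteq> (\<Union>p\<in>grid d m. sensing_cube d (1 / (2 * real m)) p)"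
proof
  fix q assume q: "q \<in> unit_cube d"
  \<comment> \<open>\<open>j l\<close> is the number of the cell of length \<open>1 / m\<close> that
    contains \<open>q l\<close>, and the midpoint of this cell is the \<open>j l\<close>-th anchor.
    The \<open>max\<close> puts \<open>q l = 0\<close>, with ceiling 0, into the first cell.\<close>
  define j where "j = (\<lambda>l. max 1 (nat \<lceil>q l * real m\<rceil>))"
  have j: "j l \<in> {1..m} \<and> \<bar>q l - anchor m 1 (j l)\<bar> \<le> 1 / (2 * real m)" if "l < d" for l
  proof -
    have ql: "0 \<le> q l" "q l \<le> 1"
      using PiE_mem[of q "{..<d}" "\<lambda>_. {0..1}" l] q that by (simp_all add: unit_cube_def)
    have "q l * real m \<le> real m" using mult_right_mono[OF ql(2), of "real m"] by simp
    then have "\<lceil>q l * real m\<rceil> \<le> int m" by (simp only: ceiling_le_iff of_int_of_nat_eq)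
    then have "j l \<in> {1..m}" using assms ql by (auto simp: j_def)
    moreover have "real (max 1 (nat \<lceil>t\<rceil>)) - 1 \<le> t \<and> t \<le> real (max 1 (nat \<lceil>t\<rceil>))"
      if "0 \<le> t" for t :: real
    proof (cases "\<lceil>t\<rceil> \<ge> 1")
      case True
      then have "max 1 (nat \<lceil>t\<rceil>) = nat \<lceil>t\<rceil>" "real (nat \<lceil>t\<rceil>) = of_int \<lceil>t\<rceil>" by linarith+
      then show ?thesis using ceiling_correct[of t] by linarith
    next
      case False
      then have "t = 0" using that ceiling_correct[of t] by linarith
      then show ?thesis by simp
    qed
    then have "real (j l) - 1 \<le> q l * real m" "q l * real m \<le> real (j l)"
      using mult_nonneg_nonneg[OF ql(1), of "real m"] unfolding j_def by simp_all
    then have "(real (j l) - 1) / real m \<le> q l" "q l \<le> real (j l) / real m"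
      using assms by (auto simp: field_simps)
    then have "\<bar>q l - anchor m 1 (j l)\<bar> \<le> 1 / (2 * real m)"
      using assms by (simp add: anchor_1 abs_le_iff field_simps)
    ultimately show ?thesis by blast
  qed
  define p where "p = (\<lambda>l\<in>{..<d}. anchor m 1 (j l))"
  have "p \<in> grid d m" using j by (auto simp: p_def grid_eq)
  moreover have "q \<in> sensing_cube d (1 / (2 * real m)) p"
  proof -
    have "q l \<in> {p l - 1 / (2 * real m)..p l + 1 / (2 * real m)}" if "l < d" for l
      using j[OF that] that by (auto simp: p_def abs_le_iff)
    then show ?thesis
      using PiE_arb[of q "{..<d}" "\<lambda>_. {0..1}"] q
      unfolding sensing_cube_def unit_cube_def by (intro PiE_I) auto
  qed
  ultimately show "q \<in> (\<Union>p\<in>grid d m. sensing_cube d (1 / (2 * real m)) p)" by blast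
qed

subsection \<open>Deviation of order statistics\<close>

text \<open>In the sorted list the entries with key at most \<open>c\<close> form an initial
  segment, whose length is the number of such sensors. Positions start at 0, which makes the
  inequality on the right strict. Thus bounds on counts turn into bounds on order
  statistics.\<close>

lemma nth_sort_key_le_iff:
  assumes "distinct S" "t < length S"
  shows "f (sort_key f S ! t) \<le> c \<longleftrightarrow> t < card {i \<in> set S. f i \<le> c}"
proof -
  define T where "T = sort_key f S"
  have T: "distinct T" "length T = length S" "set T = set S"
    using assms by (simp_all add: T_def)
  have mono: "f (T ! s) \<le> f (T ! s')" if "s \<le> s'" "s' < length S" for s s'
    using sorted_nth_mono[OF sorted_sort_key[of f S], of s s'] that by (simp add: T_def)
  have card: "card ((!) T ` A) = card A" if "A \<subseteq> {..<length S}" for A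
    by (intro card_image inj_on_nth) (use T that in auto)
  show ?thesis unfolding T_def[symmetric]
  proof
    assume "f (T ! t) \<le> c"
    then have "(!) T ` {..t} \<subseteq> {i \<in> set S. f i \<le> c}"
      using mono[of _ t] assms(2) T by (fastforce simp flip: T(3))
    then have "card ((!) T ` {..t}) \<le> card {i \<in> set S. f i \<le> c}"
      by (intro card_mono) auto
    then show "t < card {i \<in> set S. f i \<le> c}"
      using assms(2) by (subst (asm) card) auto
  next
    assume *: "t < card {i \<in> set S. f i \<le> c}"
    show "f (T ! t) \<le> c"
    proof (rule ccontr)
      assume "\<not> f (T ! t) \<le> c"
      then have "\<not> f (T ! s) \<le> c" if "t \<le> s" "s < length S" for s
        using mono[OF that] by (meson order_trans)
      then have "i \<in> (!) T ` {..<t}" if "i \<in> set T" "f i \<le> c" for i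
        using that T(2) by (metis image_eqI in_set_conv_nth lessThan_iff not_le)
      then have "{i \<in> set S. f i \<le> c} \<subseteq> (!) T ` {..<t}"
        using T(3) by blast
      then have "card {i \<in> set S. f i \<le> c} \<le> card ((!) T ` {..<t})"
        by (intro card_mono) auto
      also have "\<dots> = t" using assms(2) by (subst card) auto
      finally show False using * by simp
    qed
  qed
qed

lemma real_card_eq_sum_indicator:
  "finite A \<Longrightarrow> real (card {i \<in> A. f i \<le> (c :: real)}) = (\<Sum>i\<in>A. indicator {..c} (f i))"
  by (simp add: indicator_def sum.If_cases Int_def if_distrib cong: if_cong)

text \<open>The shell \<open>l < Z \<le> l + 1\<close> contributes at most
  \<open>(l + 1) powr a\<close> times the tail probability at \<open>l\<close>. The factor
  \<open>2 * exp (- l\<^sup>2 / 2)\<close> is the tail bound for a deviation scaled by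
  \<open>sqrt m\<close>, uniform in \<open>m\<close>.\<close>

definition tail_constant :: "real \<Rightarrow> real" where
  "tail_constant a = (\<Sum>l. (real l + 1) powr a * (2 * exp (- (real l)\<^sup>2 / 2)))"

lemma summable_tail:
  assumes "a > 0"
  shows "summable (\<lambda>l. (real l + 1) powr a * (2 * exp (- (real l)\<^sup>2 / 2)))"
proof (rule summable_comparison_test_bigo)
  show "summable (\<lambda>l. norm (1 / real l ^ 2))"
    using inverse_power_summable[of 2, where 'a = real] by (simp add: inverse_eq_divide)
  show "(\<lambda>l. (real l + 1) powr a * (2 * exp (- (real l)\<^sup>2 / 2))) \<in> O(\<lambda>l. 1 / real l ^ 2)"
    using assms by real_asymp
qed

lemma tail_constant_nonneg: "a > 0 \<Longrightarrow> tail_constant a \<ge> 0"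
  unfolding tail_constant_def by (intro suminf_nonneg summable_tail) auto

text \<open>Each value is dominated by the summand of its shell; replacing the shell by the whole
  tail \<open>Z > l\<close> only enlarges the sum.\<close>

lemma nn_integral_powr_le_suminf:
  fixes Z :: "'a \<Rightarrow> real"
  assumes [measurable]: "Z \<in> borel_measurable M" and "a > 0"
    and Z: "\<And>\<omega>. \<omega> \<in> space M \<Longrightarrow> Z \<omega> \<ge> 0"
    and tail: "\<And>l::nat. emeasure M {\<omega> \<in> space M. Z \<omega> > real l} \<le> ennreal (g l)"
  shows "(\<integral>\<^sup>+\<omega>. ennreal (Z \<omega> powr a) \<partial>M) \<le> (\<Sum>l. ennreal ((real l + 1) powr a) * ennreal (g l))"
proof -
  have le: "ennreal (Z \<omega> powr a) \<le>
      (\<Sum>l. ennreal ((real l + 1) powr a) * indicator {\<omega> \<in> space M. Z \<omega> > real l} \<omega>)"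
    (is "_ \<le> (\<Sum>l. ?f l)") if "\<omega> \<in> space M" for \<omega>
  proof (cases "Z \<omega> = 0")
    case True
    then show ?thesis using assms(2) by simp
  next
    case False
    then have pos: "Z \<omega> > 0" using Z[OF that] by simp
    \<comment> \<open>The ceiling minus 1, rather than the floor, gives
      \<open>L < Z \<omega>\<close> strictly, as the tail events demand.\<close>
    define L where "L = nat (\<lceil>Z \<omega>\<rceil> - 1)"
    have "real L = of_int \<lceil>Z \<omega>\<rceil> - 1" using pos by (simp add: L_def)
    then have L: "real L < Z \<omega>" "Z \<omega> \<le> real L + 1" using ceiling_correct[of "Z \<omega>"] by simp_all
    have "ennreal (Z \<omega> powr a) \<le> ?f L"
      using L that pos assms(2) by (auto intro!: ennreal_leI powr_mono2)
    also have "\<dots> \<le> (\<Sum>l. ?f l)"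
    proof -
      have "f L \<le> (\<Sum>l. f l)" for f :: "nat \<Rightarrow> ennreal"
        using sum_le_suminf[OF summableI, of "{L}" f] by simp
      then show ?thesis .
    qed
    finally show ?thesis .
  qed
  have "(\<integral>\<^sup>+\<omega>. ennreal (Z \<omega> powr a) \<partial>M) \<le>
      (\<integral>\<^sup>+\<omega>. (\<Sum>l. ennreal ((real l + 1) powr a) * indicator {\<omega> \<in> space M. Z \<omega> > real l} \<omega>) \<partial>M)"
    by (intro nn_integral_mono le)
  also have "\<dots> = (\<Sum>l. ennreal ((real l + 1) powr a) * emeasure M {\<omega> \<in> space M. Z \<omega> > real l})"
    by (subst nn_integral_suminf) (auto simp: nn_integral_cmult_indicator)
  also have "\<dots> \<le> (\<Sum>l. ennreal ((real l + 1) powr a) * ennreal (g l))"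
    by (intro suminf_le mult_left_mono tail) auto
  finally show ?thesis .
qed

section \<open>Order statistics of independent uniform variables\<close>

context prob_space
begin

context
  fixes U :: "'i \<Rightarrow> 'a \<Rightarrow> real" and S :: "'i list"
  assumes indep: "indep_vars (\<lambda>_. borel) U (set S)"
    and dist: "distinct S"
    and unif: "\<And>i s. i \<in> set S \<Longrightarrow> 0 \<le> s \<Longrightarrow> s \<le> 1 \<Longrightarrow> prob {\<omega> \<in> space M. U i \<omega> \<le> s} = s"
begin

lemma rv_U [measurable]: "i \<in> set S \<Longrightarrow> U i \<in> borel_measurable M"
  using indep by (simp add: indep_vars_def)

text \<open>Hoeffding's inequality for the indicators of \<open>U i \<le> c\<close>: they are
  independent, with values in \<open>[0, 1]\<close> and mean \<open>c\<close>.\<close>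

lemma count_tail:
  fixes c \<epsilon> :: real
  assumes c: "0 \<le> c" "c \<le> 1" and e: "\<epsilon> \<ge> 0" and S: "S \<noteq> []"
  shows "prob {\<omega> \<in> space M. real (card {i \<in> set S. U i \<omega> \<le> c}) \<ge> length S * c + \<epsilon>}
      \<le> exp (- 2 * \<epsilon>\<^sup>2 / length S)"
    and "prob {\<omega> \<in> space M. real (card {i \<in> set S. U i \<omega> \<le> c}) \<le> length S * c - \<epsilon>}
      \<le> exp (- 2 * \<epsilon>\<^sup>2 / length S)"
proof -
  define X where "X = (\<lambda>i \<omega>. indicator {..c} (U i \<omega>) :: real)"
  have count: "(\<Sum>i\<in>set S. X i \<omega>) = real (card {i \<in> set S. U i \<omega> \<le> c})" for \<omega>
    by (simp add: X_def real_card_eq_sum_indicator)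
  interpret Hoeffding_ineq M "set S" X "\<lambda>_. 0" "\<lambda>_. 1" "\<Sum>i\<in>set S. expectation (X i)"
  proof unfold_locales
    show "indep_vars (\<lambda>_. borel) X (set S)"
      unfolding X_def by (rule indep_vars_compose2[OF indep]) auto
    show "AE \<omega> in M. X i \<omega> \<in> {0..1}" for i
      by (auto simp: X_def indicator_def)
  qed auto
  have "expectation (X i) = c" if "i \<in> set S" for i
  proof -
    have "expectation (X i) = expectation (indicator {\<omega> \<in> space M. U i \<omega> \<le> c})"
      by (intro Bochner_Integration.integral_cong) (auto simp: X_def indicator_def)
    then show ?thesis using unif[of i c] that c by simp
  qed
  then have mean: "(\<Sum>i\<in>set S. expectation (X i)) = length S * c"
    using dist by (simp add: distinct_card)
  have "(\<Sum>i\<in>set S. (1 - 0 :: real)\<^sup>2) = length S"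
    using dist by (simp add: distinct_card)
  moreover have "real (length S) > 0" using S by simp
  ultimately show "prob {\<omega> \<in> space M. real (card {i \<in> set S. U i \<omega> \<le> c}) \<ge> length S * c + \<epsilon>}
      \<le> exp (- 2 * \<epsilon>\<^sup>2 / length S)"
    and "prob {\<omega> \<in> space M. real (card {i \<in> set S. U i \<omega> \<le> c}) \<le> length S * c - \<epsilon>}
      \<le> exp (- 2 * \<epsilon>\<^sup>2 / length S)"
    using Hoeffding_ineq_ge[OF e] Hoeffding_ineq_le[OF e] unfolding count mean by simp_all
qed

text \<open>The distribution function at 0 and 1 gives this. It disposes of thresholds outside
  \<open>[0, 1]\<close>, where \<open>count_tail\<close> does not apply.\<close>

lemma AE_in_unit_interval: "AE \<omega> in M. \<forall>i\<in>set S. 0 < U i \<omega> \<and> U i \<omega> \<le> 1"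
proof (intro AE_finite_allI)
  fix i assume i: "i \<in> set S"
  have "prob {\<omega> \<in> space M. U i \<omega> \<le> 1} = 1" "prob {\<omega> \<in> space M. U i \<omega> \<le> 0} = 0"
    using unif[OF i] by auto
  then have "AE \<omega> in M. U i \<omega> \<le> 1" "AE \<omega> in M. \<not> U i \<omega> \<le> 0"
    using i by (simp_all add: prob_Collect_eq_1 prob_Collect_eq_0)
  then show "AE \<omega> in M. 0 < U i \<omega> \<and> U i \<omega> \<le> 1"
    by eventually_elim auto
qed simp

abbreviation order_stat :: "nat \<Rightarrow> 'a \<Rightarrow> real" where
  "order_stat t \<omega> \<equiv> U (sort_key (\<lambda>i. U i \<omega>) S ! t) \<omega>"

lemma order_stat_le_iff:
  "t < length S \<Longrightarrow> order_stat t \<omega> \<le> c \<longleftrightarrow> t < card {i \<in> set S. U i \<omega> \<le> c}"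
  using nth_sort_key_le_iff[OF dist, of t "\<lambda>i. U i \<omega>" c] by simp

text \<open>Through the counts, sublevel sets become conditions on a finite sum of indicators, which
  avoids reasoning about the random sorted list.\<close>

lemma measurable_order_stat:
  assumes "t < length S"
  shows "order_stat t \<in> borel_measurable M"
proof (rule borel_measurableI_le)
  fix c
  have "order_stat t \<omega> \<le> c \<longleftrightarrow> real t < (\<Sum>i\<in>set S. indicator {..c} (U i \<omega>))" for \<omega>
    by (simp add: order_stat_le_iff[OF assms] flip: real_card_eq_sum_indicator)
  then have "{\<omega> \<in> space M. order_stat t \<omega> \<le> c} =
      {\<omega> \<in> space M. real t < (\<Sum>i\<in>set S. indicator {..c} (U i \<omega>))}"
    by simp
  also have "\<dots> \<in> sets M" by measurable
  finally show "{\<omega> \<in> space M. order_stat t \<omega> \<le> c} \<in> sets M" .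
qed

text \<open>A deviation of the order statistic is a deviation of an empirical count: the number of sensors
  to the left of \<open>q \<plusminus> s\<close> differs from its mean by at least half of \<open>s\<close> times the sample size.\<close>

lemma order_stat_tail:
  fixes q s \<delta> :: real
  assumes t: "t < length S" and q: "0 \<le> q" "q \<le> 1"
    and "real t \<le> length S * (q + \<delta>)" "length S * (q - \<delta>) \<le> real t + 1"
    and s: "2 * \<delta> \<le> s" "0 \<le> s"
  shows "prob {\<omega> \<in> space M. \<bar>order_stat t \<omega> - q\<bar> > s} \<le> 2 * exp (- real (length S) * s\<^sup>2 / 2)"
proof -
  note [measurable] = measurable_order_stat[OF t]
  let ?N = "real (length S)" and ?C = "\<lambda>c \<omega>. real (card {i \<in> set S. U i \<omega> \<le> c})"
  have S: "S \<noteq> []" using t by auto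
  have exp_eq: "- 2 * (?N * s / 2)\<^sup>2 / ?N = - ?N * s\<^sup>2 / 2"
    using S by (simp add: power2_eq_square field_simps)
  \<comment> \<open>\<open>\<delta>\<close> allows for the offset between the rank \<open>t\<close>
    and \<open>q\<close>. As \<open>2 * \<delta> \<le> s\<close>, at least \<open>s / 2\<close> of
    the deviation remains, and Hoeffding with \<open>N * s / 2\<close> gives the exponent in
    \<open>exp_eq\<close>.\<close>
  have bound: "?N * s / 2 \<le> ?N * (s - \<delta>)"
    using s(1) mult_left_mono[of "s / 2" "s - \<delta>" ?N] by simp
  have T: "sort_key (\<lambda>i. U i \<omega>) S ! t \<in> set S" for \<omega>
    using t by (metis length_sort nth_mem set_sort)
  have right: "prob {\<omega> \<in> space M. order_stat t \<omega> > q + s} \<le> exp (- ?N * s\<^sup>2 / 2)"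
  proof (cases "q + s \<le> 1")
    case True
    have "order_stat t \<omega> > q + s \<longleftrightarrow> ?C (q + s) \<omega> \<le> real t" for \<omega>
      using order_stat_le_iff[OF t, of \<omega> "q + s"] by auto
    moreover have "real t \<le> ?N * (q + s) - ?N * s / 2"
      using assms(4) bound by (simp add: algebra_simps)
    ultimately have sub: "{\<omega> \<in> space M. order_stat t \<omega> > q + s} \<subseteq>
        {\<omega> \<in> space M. ?C (q + s) \<omega> \<le> ?N * (q + s) - ?N * s / 2}"
      by force
    have "{\<omega> \<in> space M. ?C (q + s) \<omega> \<le> ?N * (q + s) - ?N * s / 2} \<in> events"
      by (simp add: real_card_eq_sum_indicator)
    note finite_measure_mono[OF sub this]
    also have "prob {\<omega> \<in> space M. ?C (q + s) \<omega> \<le> ?N * (q + s) - ?N * s / 2}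
        \<le> exp (- 2 * (?N * s / 2)\<^sup>2 / ?N)"
      using True q s S by (intro count_tail(2)) auto
    finally show ?thesis unfolding exp_eq .
  next
    case False
    have "AE \<omega> in M. \<not> order_stat t \<omega> > q + s"
      using AE_in_unit_interval
    proof eventually_elim
      case (elim \<omega>)
      then have "0 < order_stat t \<omega> \<and> order_stat t \<omega> \<le> 1" using T by blast
      then show ?case using False by linarith
    qed
    then have "prob {\<omega> \<in> space M. order_stat t \<omega> > q + s} = 0"
      by (simp add: prob_Collect_eq_0)
    then show ?thesis by simp
  qed
  have left: "prob {\<omega> \<in> space M. order_stat t \<omega> \<le> q - s} \<le> exp (- ?N * s\<^sup>2 / 2)"
  proof (cases "0 \<le> q - s")
    case True
    have "order_stat t \<omega> \<le> q - s \<longleftrightarrow> real t + 1 \<le> ?C (q - s) \<omega>" for \<omega>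
      using order_stat_le_iff[OF t, of \<omega> "q - s"] by auto
    moreover have "?N * (q - s) + ?N * s / 2 \<le> real t + 1"
      using assms(5) bound by (simp add: algebra_simps)
    ultimately have sub: "{\<omega> \<in> space M. order_stat t \<omega> \<le> q - s} \<subseteq>
        {\<omega> \<in> space M. ?C (q - s) \<omega> \<ge> ?N * (q - s) + ?N * s / 2}"
      by force
    have "{\<omega> \<in> space M. ?C (q - s) \<omega> \<ge> ?N * (q - s) + ?N * s / 2} \<in> events"
      by (simp add: real_card_eq_sum_indicator)
    note finite_measure_mono[OF sub this]
    also have "prob {\<omega> \<in> space M. ?C (q - s) \<omega> \<ge> ?N * (q - s) + ?N * s / 2}
        \<le> exp (- 2 * (?N * s / 2)\<^sup>2 / ?N)"
      using True q s S by (intro count_tail(1)) auto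
    finally show ?thesis unfolding exp_eq .
  next
    case False
    have "AE \<omega> in M. \<not> order_stat t \<omega> \<le> q - s"
      using AE_in_unit_interval
    proof eventually_elim
      case (elim \<omega>)
      then have "0 < order_stat t \<omega> \<and> order_stat t \<omega> \<le> 1" using T by blast
      then show ?case using False by linarith
    qed
    then have "prob {\<omega> \<in> space M. order_stat t \<omega> \<le> q - s} = 0"
      by (simp add: prob_Collect_eq_0)
    then show ?thesis by simp
  qed
  have "prob {\<omega> \<in> space M. \<bar>order_stat t \<omega> - q\<bar> > s} \<le>
      prob ({\<omega> \<in> space M. order_stat t \<omega> > q + s} \<union> {\<omega> \<in> space M. order_stat t \<omega> \<le> q - s})"
    by (intro finite_measure_mono) auto
  also have "\<dots> \<le> prob {\<omega> \<in> space M. order_stat t \<omega> > q + s} + prob {\<omega> \<in> space M. order_stat t \<omega> \<le> q - s}"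
    by (intro measure_Un_le) auto
  finally show ?thesis using left right by simp
qed

text \<open>The anchor is the midpoint of the cell of length \<open>1 / m\<close> with number
  \<open>t div b + 1\<close>, and \<open>t / N\<close> lies in that cell, so
  \<open>order_stat_tail\<close> applies with \<open>\<delta> = 1 / (2 * m)\<close>. Scaling the
  deviation by \<open>sqrt m\<close> then gives a tail bound independent of \<open>m\<close> and
  \<open>b\<close>.\<close>

lemma order_stat_moment:
  assumes m: "m \<ge> 1" and N: "length S = m * b" and t: "t < length S" and a: "a > 0"
  shows "(\<integral>\<^sup>+\<omega>. ennreal (\<bar>order_stat t \<omega> - anchor m 1 (Suc (t div b))\<bar> powr a) \<partial>M)
    \<le> ennreal (tail_constant a * real m powr (- a / 2))"
proof -
  note [measurable] = measurable_order_stat[OF t]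
  define q where "q = anchor m 1 (Suc (t div b))"
  have b: "b \<ge> 1" using N t by (cases b) auto
  have "t div b < m" using t N by (simp add: less_mult_imp_div_less)
  then have tm: "real (t div b) + 1 \<le> real m" by linarith
  have q_eq: "q = (real (t div b) + 1 / 2) / real m"
    using m by (simp add: q_def anchor_def field_simps)
  have q: "0 \<le> q" "q \<le> 1" using tm m by (simp_all add: q_eq)
  \<comment> \<open>The two ends of the cell, multiplied by the sample size, are the block
    boundaries, so \<open>near\<close> merely places position \<open>t\<close> in its block.\<close>
  have Nq: "real (length S) * (q + 1 / (2 * real m)) = (real (t div b) + 1) * real b"
    "real (length S) * (q - 1 / (2 * real m)) = real (t div b) * real b"
    using m by (simp_all add: N q_eq field_simps)
  have "t = t div b * b + t mod b" "t mod b < b"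
    using b by simp_all
  then have "t \<le> (t div b + 1) * b" "t div b * b \<le> t + 1"
    unfolding distrib_right by linarith+
  then have "real t \<le> real ((t div b + 1) * b)" "real (t div b * b) \<le> real (t + 1)"
    by (simp_all only: of_nat_le_iff)
  then have near: "real t \<le> real (length S) * (q + 1 / (2 * real m))"
    "real (length S) * (q - 1 / (2 * real m)) \<le> real t + 1"
    unfolding Nq by (simp_all add: algebra_simps)
  define Z where "Z = (\<lambda>\<omega>. \<bar>order_stat t \<omega> - q\<bar> * sqrt m)"
  have tail: "emeasure M {\<omega> \<in> space M. Z \<omega> > real l} \<le> ennreal (2 * exp (- (real l)\<^sup>2 / 2))" for l
  \<comment> \<open>For \<open>l = 0\<close> the threshold is 0 and
    \<open>2 * \<delta> \<le> s\<close> fails, but the claimed bound is 2 and thus trivial.\<close>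
  proof (cases "l = 0")
    case True
    have "prob {\<omega> \<in> space M. Z \<omega> > real l} \<le> 2"
      using prob_le_1[of "{\<omega> \<in> space M. Z \<omega> > real l}"] by linarith
    then have "ennreal (prob {\<omega> \<in> space M. Z \<omega> > real l}) \<le> ennreal 2"
      by (rule ennreal_leI)
    then show ?thesis using True by (simp add: emeasure_eq_measure)
  next
    case False
    define s where "s = real l / sqrt m"
    have "sqrt (real m) \<le> real m"
      using m by (intro real_le_lsqrt) (simp_all add: power2_eq_square)
    then have "sqrt (real m) * 1 \<le> real m * real l"
      using False by (intro mult_mono) auto
    then have s: "2 * (1 / (2 * real m)) \<le> s"
      using m by (simp add: s_def field_simps)
    have "{\<omega> \<in> space M. Z \<omega> > real l} = {\<omega> \<in> space M. \<bar>order_stat t \<omega> - q\<bar> > s}"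
      using m by (auto simp: Z_def s_def field_simps)
    then have "prob {\<omega> \<in> space M. Z \<omega> > real l} \<le> 2 * exp (- real (length S) * s\<^sup>2 / 2)"
      using order_stat_tail[OF t q near s] by (simp add: s_def)
    \<comment> \<open>Here \<open>N * s\<^sup>2 = b * l\<^sup>2\<close>, and
      \<open>b \<ge> 1\<close>.\<close>
    also have "\<dots> \<le> 2 * exp (- (real l)\<^sup>2 / 2)"
      using m b mult_right_mono[of 1 "real b" "(real l)\<^sup>2"] by (simp add: s_def N power_divide)
    finally show ?thesis by (simp add: emeasure_eq_measure ennreal_leI)
  qed
  have "(\<integral>\<^sup>+\<omega>. ennreal (Z \<omega> powr a) \<partial>M) \<le>
      (\<Sum>l. ennreal ((real l + 1) powr a) * ennreal (2 * exp (- (real l)\<^sup>2 / 2)))"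
    by (rule nn_integral_powr_le_suminf[OF _ a _ tail]) (auto simp: Z_def)
  also have "\<dots> = ennreal (tail_constant a)"
    unfolding tail_constant_def using summable_tail[OF a]
    by (subst suminf_ennreal2[symmetric]) (auto simp: ennreal_mult'')
  finally have Z: "(\<integral>\<^sup>+\<omega>. ennreal (Z \<omega> powr a) \<partial>M) \<le> ennreal (tail_constant a)" .
  have "\<bar>order_stat t \<omega> - q\<bar> powr a = real m powr (- a / 2) * Z \<omega> powr a" for \<omega>
    using m by (simp add: Z_def powr_mult powr_half_sqrt[symmetric] powr_powr powr_add[symmetric] mult.left_commute)
  then have "(\<integral>\<^sup>+\<omega>. ennreal (\<bar>order_stat t \<omega> - q\<bar> powr a) \<partial>M) =
      ennreal (real m powr (- a / 2)) * (\<integral>\<^sup>+\<omega>. ennreal (Z \<omega> powr a) \<partial>M)"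
    by (subst nn_integral_cmult[symmetric]) (auto simp: Z_def ennreal_mult'')
  also have "\<dots> \<le> ennreal (real m powr (- a / 2)) * ennreal (tail_constant a)"
    by (intro mult_left_mono Z) auto
  finally show ?thesis
    by (simp add: q_def ennreal_mult'' tail_constant_nonneg[OF a] mult.commute)
qed

end

end

subsection \<open>Expected cost of a run\<close>

lemma measurable_insort_key:
  fixes f :: "'a \<Rightarrow> 'i \<Rightarrow> real"
  assumes [measurable]: "\<And>i. (\<lambda>\<omega>. f \<omega> i) \<in> borel_measurable M"
  shows "(\<lambda>\<omega>. insort_key (f \<omega>) a T) \<in> measurable M (count_space UNIV)"
proof (induction T)
  case (Cons b T)
  have "(\<lambda>\<omega>. b # insort_key (f \<omega>) a T) \<in> measurable M (count_space UNIV)"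
    by (rule measurable_compose[OF Cons]) simp
  then show ?case by simp
qed simp

text \<open>Lists over a countable type are countable, so measurability can be checked with the
  sorted tail held fixed.\<close>

lemma measurable_sort_key:
  fixes f :: "'a \<Rightarrow> 'i::countable \<Rightarrow> real"
  assumes "\<And>i. (\<lambda>\<omega>. f \<omega> i) \<in> borel_measurable M"
  shows "(\<lambda>\<omega>. sort_key (f \<omega>) S) \<in> measurable M (count_space UNIV)"
proof (induction S)
  case (Cons a S)
  have "(\<lambda>\<omega>. insort_key (f \<omega>) a (sort_key (f \<omega>) S)) \<in> measurable M (count_space UNIV)"
    by (rule measurable_compose_countable[OF measurable_insort_key[OF assms] Cons])
  then show ?case by simp
qed simp

lemma measurable_target:
  fixes X :: "'a \<Rightarrow> nat \<Rightarrow> nat \<Rightarrow> real"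
  assumes "\<And>i l. (\<lambda>\<omega>. X \<omega> i l) \<in> borel_measurable M"
  shows "(\<lambda>\<omega>. target d m (X \<omega>) r S i l) \<in> measurable M (count_space UNIV)"
proof (induction r arbitrary: S)
  case (Suc r)
  \<comment> \<open>\<open>G\<close> takes the sorted list as a separate argument; for each of the
    countably many lists the induction hypothesis applies.\<close>
  define G where "G = (\<lambda>T \<omega>. let j = block_index (m ^ r) T i
      in if l = d - Suc r then j else target d m (X \<omega>) r (block (m ^ r) j T) i l)"
  have "(\<lambda>\<omega>. G (sort_key (\<lambda>i. X \<omega> i (d - Suc r)) S) \<omega>) \<in> measurable M (count_space UNIV)"
  proof (rule measurable_compose_countable[where f = G and g = "\<lambda>\<omega>. sort_key (\<lambda>i. X \<omega> i (d - Suc r)) S"])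
    show "G T \<in> measurable M (count_space UNIV)" for T
      using Suc.IH by (cases "l = d - Suc r") (simp_all add: G_def Let_def)
    show "(\<lambda>\<omega>. sort_key (\<lambda>i. X \<omega> i (d - Suc r)) S) \<in> measurable M (count_space UNIV)"
      by (rule measurable_sort_key[OF assms])
  qed
  then show ?case by (simp add: G_def Let_def)
qed simp

text \<open>Powers are taken of each single move, not of a sensor's total, which makes the cost
  additive over coordinates and blocks and thus suited to the recursion.\<close>

definition cost :: "nat \<Rightarrow> nat \<Rightarrow> real \<Rightarrow> nat \<Rightarrow> nat list \<Rightarrow> (nat \<Rightarrow> point) \<Rightarrow> real" where
  "cost d m a r S x =
     (\<Sum>i\<in>set S. \<Sum>l = d - r..<d. \<bar>x i l - anchor m 1 (target d m x r S i l)\<bar> powr a)"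

lemma cost_nonneg: "cost d m a r S x \<ge> 0"
  unfolding cost_def by (intro sum_nonneg) auto

lemma cost_cong:
  assumes "r \<le> d" "\<And>i l. i \<in> set S \<Longrightarrow> d - r \<le> l \<Longrightarrow> l < d \<Longrightarrow> x i l = x' i l"
  shows "cost d m a r S x = cost d m a r S x'"
  unfolding cost_def using assms target_cong[OF assms] by (auto intro!: sum.cong)

lemma measurable_cost:
  fixes X :: "'a \<Rightarrow> nat \<Rightarrow> nat \<Rightarrow> real"
  assumes [measurable]: "\<And>i l. (\<lambda>\<omega>. X \<omega> i l) \<in> borel_measurable M"
  shows "(\<lambda>\<omega>. cost d m a r S (X \<omega>)) \<in> borel_measurable M"
proof -
  have [measurable]: "(\<lambda>\<omega>. anchor m 1 (target d m (X \<omega>) r S i l)) \<in> borel_measurable M" for i l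
    by (rule measurable_compose[OF measurable_target[OF assms]]) simp
  show ?thesis unfolding cost_def by measurable
qed

text \<open>The moves along the axis treated first are listed by rank, so that order statistics
  appear; the later ones are grouped by block, since by \<open>in_set_block_iff\<close> the blocks
  partition the sensors.\<close>

lemma cost_Suc:
  fixes x :: "nat \<Rightarrow> point"
  assumes "Suc r \<le> d" "m \<ge> 1" "distinct S" "length S = m ^ Suc r"
  defines "T \<equiv> sort_key (\<lambda>i. x i (d - Suc r)) S"
  shows "cost d m a (Suc r) S x =
    (\<Sum>t<length S. \<bar>x (T ! t) (d - Suc r) - anchor m 1 (Suc (t div m ^ r))\<bar> powr a) +
    (\<Sum>j = 1..m. cost d m a r (block (m ^ r) j T) x)"
proof -
  define k where "k = d - Suc r"
  define D where "D = (\<lambda>S r i l. \<bar>x i l - anchor m 1 (target d m x r S i l)\<bar> powr a)"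
  define J where "J = block_index (m ^ r) T"
  have T: "distinct T" "length T = m * m ^ r" "set T = set S"
    using assms by (simp_all add: T_def)
  have k: "d - r = Suc k" "k < d" using assms(1) by (auto simp: k_def)
  have Dk: "D S (Suc r) i k = \<bar>x i k - anchor m 1 (J i)\<bar> powr a" for i
    by (simp add: D_def J_def k_def T_def Let_def)
  have Dl: "D S (Suc r) i l = D (block (m ^ r) (J i) T) r i l" if "l \<noteq> k" for i l
    using that by (simp add: D_def J_def k_def T_def Let_def)
  have "cost d m a (Suc r) S x = (\<Sum>i\<in>set T. \<Sum>l = k..<d. D S (Suc r) i l)"
    by (simp only: cost_def D_def k_def T(3))
  also have "\<dots> = (\<Sum>i\<in>set T. \<bar>x i k - anchor m 1 (J i)\<bar> powr a) +
      (\<Sum>i\<in>set T. \<Sum>l = Suc k..<d. D (block (m ^ r) (J i) T) r i l)"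
    using k(2) by (simp add: sum.atLeast_Suc_lessThan Dk Dl sum.distrib)
  also have "(\<Sum>i\<in>set T. \<bar>x i k - anchor m 1 (J i)\<bar> powr a) =
      (\<Sum>t<length S. \<bar>x (T ! t) k - anchor m 1 (Suc (t div m ^ r))\<bar> powr a)"
    using T assms(4)
    by (intro sum.reindex_bij_betw[OF bij_betw_nth[OF T(1) refl refl], symmetric, THEN trans] sum.cong)
      (auto simp: J_def block_index_nth)
  also have "(\<Sum>i\<in>set T. \<Sum>l = Suc k..<d. D (block (m ^ r) (J i) T) r i l) =
      (\<Sum>j = 1..m. \<Sum>i\<in>{i \<in> set T. J i = j}. \<Sum>l = Suc k..<d. D (block (m ^ r) (J i) T) r i l)"
    using block_index_in_range[OF T(1,2)] by (intro sum.group[symmetric]) (auto simp: J_def)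
  also have "\<dots> = (\<Sum>j = 1..m. cost d m a r (block (m ^ r) j T) x)"
  proof (intro sum.cong refl)
    fix j assume "j \<in> {1..m}"
    then have "{i \<in> set T. J i = j} = set (block (m ^ r) j T)"
      using in_set_block_iff[OF T(1), of "m ^ r" j] assms(2) by (auto simp: J_def)
    then show "(\<Sum>i\<in>{i \<in> set T. J i = j}. \<Sum>l = Suc k..<d. D (block (m ^ r) (J i) T) r i l) =
        cost d m a r (block (m ^ r) j T) x"
      unfolding cost_def k(1) D_def by (intro sum.cong) auto
  qed
  finally show ?thesis by (simp add: k_def)
qed

section \<open>Products of uniform distributions and their coordinates\<close>

abbreviation uniform_interval :: "real measure" where
  "uniform_interval \<equiv> uniform_measure lborel {0..1}"

lemma prob_space_uniform_interval: "prob_space uniform_interval"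
  by (rule prob_space_uniform_measure) auto

interpretation unif: product_sigma_finite "\<lambda>_ :: 'i. uniform_interval"
  by (simp add: product_sigma_finite_def prob_space_uniform_interval prob_space_imp_sigma_finite)

abbreviation uniform_product :: "'i set \<Rightarrow> ('i \<Rightarrow> real) measure" where
  "uniform_product J \<equiv> PiM J (\<lambda>_. uniform_interval)"

text \<open>Independence amounts to the joint law being the product of the marginals; for a
  selection of coordinates the joint law is found by reindexing the product.\<close>

lemma indep_vars_PiM_coords:
  assumes M: "\<And>p. p \<in> J \<Longrightarrow> prob_space (M p)" and g: "inj_on g K" "g \<in> K \<rightarrow> J" and K: "K \<noteq> {}"
  shows "prob_space.indep_vars (PiM J M) (\<lambda>i. M (g i)) (\<lambda>i \<omega>. \<omega> (g i)) K"
proof -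
  interpret prob_space "PiM J M" by (intro prob_space_PiM M)
  have "distr (PiM J M) (\<Pi>\<^sub>M i\<in>K. M (g i)) (\<lambda>\<omega>. \<lambda>i\<in>K. \<omega> (g i)) = (\<Pi>\<^sub>M i\<in>K. M (g i))"
    by (rule distr_PiM_reindex[OF M g])
  also have "\<dots> = (\<Pi>\<^sub>M i\<in>K. distr (PiM J M) (M (g i)) (\<lambda>\<omega>. \<omega> (g i)))"
    using g(2) M by (intro PiM_cong refl distr_PiM_component[symmetric]) auto
  finally show ?thesis
    using g(2) by (subst indep_vars_iff_distr_eq_PiM'[OF K]) (auto intro: measurable_component_singleton)
qed

text \<open>Outside \<open>J\<close> the coordinate is constantly \<open>undefined\<close>. Covering
  all coordinates fits \<open>measurable_cost\<close>, which asks for every \<open>i\<close> and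
  \<open>l\<close>.\<close>

lemma measurable_uniform_product_coord:
  "(\<lambda>\<omega>. \<omega> p) \<in> borel_measurable (uniform_product J)"
proof (cases "p \<in> J")
  case True
  then have "(\<lambda>\<omega>. \<omega> p) \<in> measurable (uniform_product J) uniform_interval"
    by (rule measurable_component_singleton)
  then show ?thesis by (simp cong: measurable_cong_sets)
next
  case False
  have "(\<lambda>\<omega>. \<omega> p) \<in> borel_measurable (uniform_product J) \<longleftrightarrow>
      (\<lambda>\<omega>. undefined :: real) \<in> borel_measurable (uniform_product J)"
    by (rule measurable_cong) (use False in \<open>auto simp: space_PiM PiE_def extensional_def\<close>)
  then show ?thesis by simp
qed

text \<open>Column \<open>k\<close> of the product consists of independent uniform variables, one
  for each sensor, so \<open>order_stat_moment\<close> applies.\<close>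

lemma nn_integral_order_stat_uniform_product:
  assumes "finite I" "distinct S" "set S \<subseteq> I" "m \<ge> 1" "length S = m * b" "t < length S" "a > 0"
  shows "(\<integral>\<^sup>+\<omega>. ennreal (\<bar>\<omega> (sort_key (\<lambda>i. \<omega> (i, k)) S ! t, k) - anchor m 1 (Suc (t div b))\<bar> powr a)
      \<partial>uniform_product (I \<times> {k})) \<le> ennreal (tail_constant a * real m powr (- a / 2))"
proof -
  interpret P: prob_space "uniform_product (I \<times> {k})"
    by (intro prob_space_PiM prob_space_uniform_interval)
  have "P.indep_vars (\<lambda>_. uniform_interval) (\<lambda>i \<omega>. \<omega> (i, k)) (set S)"
    using assms(3,6)
    by (intro indep_vars_PiM_coords[where M = "\<lambda>_. uniform_interval" and g = "\<lambda>i. (i, k)"]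
        prob_space_uniform_interval) (auto simp: inj_on_def)
  then have indep: "P.indep_vars (\<lambda>_. borel) (\<lambda>i \<omega>. \<omega> (i, k)) (set S)"
    by (rule P.indep_vars_compose2[where Y = "\<lambda>_ x. x"]) (simp add: measurable_ident_sets)
  have unif: "P.prob {\<omega> \<in> space (uniform_product (I \<times> {k})). \<omega> (i, k) \<le> s} = s"
    if "i \<in> set S" "0 \<le> s" "s \<le> 1" for i s
  proof -
    have "(i, k) \<in> I \<times> {k}" using that assms(3) by auto
    then have "emeasure (distr (uniform_product (I \<times> {k})) uniform_interval (\<lambda>\<omega>. \<omega> (i, k))) {..s}
        = emeasure uniform_interval {..s}"
      by (subst distr_PiM_component) (auto intro: prob_space_uniform_interval)
    then have "emeasure (uniform_product (I \<times> {k})) {\<omega> \<in> space (uniform_product (I \<times> {k})). \<omega> (i, k) \<le> s}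
        = emeasure uniform_interval {..s}"
      using measurable_component_singleton[OF \<open>(i, k) \<in> I \<times> {k}\<close>, of "\<lambda>_. uniform_interval"]
      by (subst (asm) emeasure_distr) (auto simp: vimage_def Int_def conj_commute)
    also have "\<dots> = ennreal s"
      using that by (simp add: emeasure_uniform_measure min_def Int_atLeastAtMost divide_ennreal_def flip: atLeastAtMost_def)
    finally show ?thesis using that by (simp add: P.emeasure_eq_measure)
  qed
  show ?thesis
    by (rule P.order_stat_moment[OF indep assms(2) unif assms(4-7)])
qed

text \<open>The coordinates after \<open>k\<close> are integrated first, with column
  \<open>k\<close> fixed. The blocks are then fixed lists, determined by column \<open>k\<close>
  alone, and the induction hypothesis bounds each of the \<open>m\<close> blocks uniformly. Column
  \<open>k\<close> itself costs at most \<open>C\<close> per rank. Keeping all of \<open>I\<close>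
  in the product while the blocks shrink lets one measure serve every block.\<close>

lemma nn_integral_cost_le:
  assumes "finite I" "m \<ge> 1" "a > 0"
    and "r \<le> d" "distinct S" "set S \<subseteq> I" "length S = m ^ r"
  shows "(\<integral>\<^sup>+\<omega>. ennreal (cost d m a r S (\<lambda>i l. \<omega> (i, l))) \<partial>uniform_product (I \<times> {d - r..<d}))
    \<le> ennreal (real r * real (m ^ r) * (tail_constant a * real m powr (- a / 2)))"
  using assms(4-)
proof (induction r arbitrary: S)
  case 0
  then show ?case by (simp add: cost_def)
next
  case (Suc r)
  define k where "k = d - Suc r"
  define C where "C = tail_constant a * real m powr (- a / 2)"
  have C: "C \<ge> 0" using tail_constant_nonneg[OF assms(3)] by (simp add: C_def)
  have k: "d - r = Suc k" "k < d" using Suc.prems(1) by (auto simp: k_def)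
  define T where "T = (\<lambda>x :: nat \<times> nat \<Rightarrow> real. sort_key (\<lambda>i. x (i, k)) S)"
  define A where "A = (\<lambda>x t. \<bar>x (T x ! t, k) - anchor m 1 (Suc (t div m ^ r))\<bar> powr a)"
  let ?I = "I \<times> {k}" and ?J = "I \<times> {Suc k..<d}"
  have IJ: "I \<times> {k..<d} = ?I \<union> ?J" using k by auto
  have coord [measurable]: "\<And>i l. (\<lambda>\<omega>. \<omega> (i, l)) \<in> borel_measurable (uniform_product J)"
    for J :: "(nat \<times> nat) set"
    by (rule measurable_uniform_product_coord)
  have T: "distinct (T x)" "length (T x) = m * m ^ r" "set (T x) = set S" for x
    using Suc.prems by (simp_all add: T_def)
  have [measurable]: "(\<lambda>x. A x t) \<in> borel_measurable (uniform_product ?I)" for t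
  proof -
    have "T \<in> measurable (uniform_product ?I) (count_space UNIV)"
      unfolding T_def by (intro measurable_sort_key coord)
    then have "(\<lambda>x. x (T x ! t, k)) \<in> borel_measurable (uniform_product ?I)"
      by (rule measurable_compose_countable[where f = "\<lambda>T x. x (T ! t, k)", rotated]) measurable
    then show ?thesis unfolding A_def by measurable
  qed
  \<comment> \<open>\<open>x\<close> holds column \<open>k\<close> and \<open>y\<close> the later
    coordinates; \<open>y\<close> influences neither the blocks nor the cost on axis
    \<open>k\<close>.\<close>
  have split: "cost d m a (Suc r) S (\<lambda>i l. merge ?I ?J (x, y) (i, l)) =
      (\<Sum>t<length S. A x t) + (\<Sum>j = 1..m. cost d m a r (block (m ^ r) j (T x)) (\<lambda>i l. y (i, l)))" for x y
  proof -
    let ?x = "\<lambda>i l. merge ?I ?J (x, y) (i, l)"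
    have left: "?x i k = x (i, k)" if "i \<in> set S" for i
      using that Suc.prems(3) by (auto simp: merge_def)
    have right: "?x i l = y (i, l)" if "i \<in> set S" "Suc k \<le> l" "l < d" for i l
      using that Suc.prems(3) by (auto simp: merge_def)
    have Tx: "sort_key (\<lambda>i. ?x i k) S = T x"
      unfolding T_def by (rule sort_key_cong) (rule left)
    have "cost d m a r (block (m ^ r) j (T x)) ?x = cost d m a r (block (m ^ r) j (T x)) (\<lambda>i l. y (i, l))" for j
      using set_block_subset[of "m ^ r" j "T x"] T(3)[of x] Suc.prems(1)
      by (intro cost_cong right) (auto simp: k)
    moreover have "?x (T x ! t) k = x (T x ! t, k)" if "t < length S" for t
      using that T(3)[of x] by (intro left) (metis T_def length_sort nth_mem)
    ultimately show ?thesis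
      using Suc.prems assms(2) by (simp add: cost_Suc Tx A_def flip: k_def)
  qed
  have inner: "(\<integral>\<^sup>+y. ennreal (cost d m a (Suc r) S (\<lambda>i l. merge ?I ?J (x, y) (i, l))) \<partial>uniform_product ?J)
      \<le> (\<Sum>t<length S. ennreal (A x t)) + ennreal (real m * (real r * real (m ^ r) * C))" for x
  proof -
    interpret J: prob_space "uniform_product ?J"
      by (intro prob_space_PiM prob_space_uniform_interval)
    have A0: "A x t \<ge> 0" for t by (simp add: A_def)
    have [measurable]: "(\<lambda>y. cost d m a r S' (\<lambda>i l. y (i, l))) \<in> borel_measurable (uniform_product ?J)" for S'
      by (intro measurable_cost coord)
    have "(\<integral>\<^sup>+y. ennreal (cost d m a (Suc r) S (\<lambda>i l. merge ?I ?J (x, y) (i, l))) \<partial>uniform_product ?J) =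
        (\<integral>\<^sup>+y. (\<Sum>t<length S. ennreal (A x t)) +
          (\<Sum>j = 1..m. ennreal (cost d m a r (block (m ^ r) j (T x)) (\<lambda>i l. y (i, l)))) \<partial>uniform_product ?J)"
      by (simp add: split sum_ennreal sum_nonneg A0 cost_nonneg flip: ennreal_plus)
    also have "\<dots> = (\<Sum>t<length S. ennreal (A x t)) +
        (\<Sum>j = 1..m. \<integral>\<^sup>+y. ennreal (cost d m a r (block (m ^ r) j (T x)) (\<lambda>i l. y (i, l))) \<partial>uniform_product ?J)"
      by (subst nn_integral_add) (simp_all add: nn_integral_sum J.emeasure_space_1)
    \<comment> \<open>For fixed \<open>x\<close> each block is a constant list, so the induction
      hypothesis applies although the block depends on \<open>x\<close>.\<close>
    also have "\<dots> \<le> (\<Sum>t<length S. ennreal (A x t)) + (\<Sum>j = 1..m. ennreal (real r * real (m ^ r) * C))"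
    proof (intro add_mono order_refl sum_mono)
      fix j assume "j \<in> {1..m}"
      then show "(\<integral>\<^sup>+y. ennreal (cost d m a r (block (m ^ r) j (T x)) (\<lambda>i l. y (i, l))) \<partial>uniform_product ?J)
          \<le> ennreal (real r * real (m ^ r) * C)"
        using Suc.IH[of "block (m ^ r) j (T x)"] set_block_subset[of "m ^ r" j "T x"] Suc.prems T
        by (simp add: k(1) C_def distinct_block length_block)
    qed
    also have "(\<Sum>j = 1..m. ennreal (real r * real (m ^ r) * C)) = ennreal (real m * (real r * real (m ^ r) * C))"
      using C by (subst sum_ennreal) auto
    finally show ?thesis .
  qed
  interpret I: prob_space "uniform_product ?I"
    by (intro prob_space_PiM prob_space_uniform_interval)
  have fin: "finite ?I" "finite ?J" using assms(1) by auto
  have "(\<integral>\<^sup>+\<omega>. ennreal (cost d m a (Suc r) S (\<lambda>i l. \<omega> (i, l))) \<partial>uniform_product (I \<times> {k..<d})) =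
    (\<integral>\<^sup>+x. \<integral>\<^sup>+y. ennreal (cost d m a (Suc r) S (\<lambda>i l. merge ?I ?J (x, y) (i, l))) \<partial>uniform_product ?J \<partial>uniform_product ?I)"
    unfolding IJ using fin
    by (intro unif.product_nn_integral_fold measurable_compose[OF measurable_cost measurable_ennreal] coord) auto
  also have "\<dots> \<le> (\<integral>\<^sup>+x. (\<Sum>t<length S. ennreal (A x t)) + ennreal (real m * (real r * real (m ^ r) * C)) \<partial>uniform_product ?I)"
    by (intro nn_integral_mono inner)
  also have "\<dots> = (\<Sum>t<length S. \<integral>\<^sup>+x. ennreal (A x t) \<partial>uniform_product ?I) + ennreal (real m * (real r * real (m ^ r) * C))"
    by (subst nn_integral_add) (simp_all add: nn_integral_sum I.emeasure_space_1)
  also have "\<dots> \<le> (\<Sum>t<length S. ennreal C) + ennreal (real m * (real r * real (m ^ r) * C))"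
    unfolding A_def T_def C_def using Suc.prems assms
    by (intro add_mono order_refl sum_mono nn_integral_order_stat_uniform_product) auto
  also have "\<dots> = ennreal (real (length S) * C + real m * (real r * real (m ^ r) * C))"
    using C by (subst sum_ennreal) (auto simp flip: ennreal_plus)
  also have "real (length S) * C + real m * (real r * real (m ^ r) * C) = real (Suc r) * real (m ^ Suc r) * C"
    using Suc.prems by (simp add: algebra_simps)
  finally show ?case by (simp add: C_def k_def)
qed

subsection \<open>The random placement\<close>

text \<open>Both measures agree on boxes, where each is the product of the lengths of the sides cut
  with \<open>{0..1}\<close>; the cube has volume 1, so normalization changes nothing.\<close>

lemma uniform_cube_eq: "uniform_cube d = uniform_product {..<d}"
  unfolding uniform_cube_def
proof (rule unif.PiM_eqI)
  interpret lborel: product_sigma_finite "\<lambda>_ :: nat. lborel :: real measure"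
    by (simp add: product_sigma_finite_def sigma_finite_lborel)
  have cube: "unit_cube d \<in> sets (\<Pi>\<^sub>M k\<in>{..<d}. lborel)"
    unfolding unit_cube_def by (intro sets_PiM_I_finite) auto
  have one: "emeasure (\<Pi>\<^sub>M k\<in>{..<d}. lborel) (unit_cube d) = 1"
    unfolding unit_cube_def by (subst lborel.emeasure_PiM) auto
  show "sets (uniform_measure (\<Pi>\<^sub>M k\<in>{..<d}. lborel) (unit_cube d)) = sets (uniform_product {..<d})"
    unfolding sets_uniform_measure by (rule sets_PiM_cong) simp_all
  fix A :: "nat \<Rightarrow> real set"
  assume A: "\<And>k. k \<in> {..<d} \<Longrightarrow> A k \<in> sets uniform_interval"
  then have A': "Pi\<^sub>E {..<d} A \<in> sets (\<Pi>\<^sub>M k\<in>{..<d}. lborel)"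
    by (intro sets_PiM_I_finite) auto
  have "emeasure (uniform_measure (\<Pi>\<^sub>M k\<in>{..<d}. lborel) (unit_cube d)) (Pi\<^sub>E {..<d} A) =
      emeasure (\<Pi>\<^sub>M k\<in>{..<d}. lborel) (Pi\<^sub>E {..<d} (\<lambda>k. {0..1} \<inter> A k))"
    unfolding emeasure_uniform_measure[OF cube A'] one
    by (simp add: unit_cube_def PiE_Int divide_ennreal_def)
  also have "\<dots> = (\<Prod>k<d. emeasure uniform_interval (A k))"
    using A by (subst lborel.emeasure_PiM) (auto intro!: prod.cong simp: divide_ennreal_def)
  finally show "emeasure (uniform_measure (\<Pi>\<^sub>M k\<in>{..<d}. lborel) (unit_cube d)) (Pi\<^sub>E {..<d} A) =
      (\<Prod>k\<in>{..<d}. emeasure uniform_interval (A k))" .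
qed simp

text \<open>Rows of the flat family use disjoint coordinates, hence are independent, and each row
  has the product law; so their joint law is the nested product. The nested form is organised by
  sensors, whereas the flat form allows the split by axes.\<close>

lemma PiM_PiM_eq_distr:
  assumes M: "\<And>i k. i \<in> I \<Longrightarrow> k \<in> K \<Longrightarrow> prob_space (M i k)" and I: "I \<noteq> {}" and K: "K \<noteq> {}"
  shows "(\<Pi>\<^sub>M i\<in>I. \<Pi>\<^sub>M k\<in>K. M i k) =
    distr (\<Pi>\<^sub>M p\<in>I \<times> K. M (fst p) (snd p)) (\<Pi>\<^sub>M i\<in>I. \<Pi>\<^sub>M k\<in>K. M i k) (\<lambda>\<omega>. \<lambda>i\<in>I. \<lambda>k\<in>K. \<omega> (i, k))"
proof -
  let ?M = "\<lambda>p. M (fst p) (snd p)"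
  let ?P = "PiM (I \<times> K) ?M"
  have M': "prob_space (?M p)" if "p \<in> I \<times> K" for p using M that by auto
  interpret P: prob_space ?P by (intro prob_space_PiM M')
  have rv: "(\<lambda>\<omega>. \<lambda>k\<in>K. \<omega> (i, k)) \<in> measurable (PiM ({i} \<times> K) ?M) (PiM K (M i))" for i
    by (intro measurable_restrict) (auto intro: measurable_component_singleton[of "(i, _)" _ ?M, simplified])
  have rvP: "(\<lambda>\<omega>. \<lambda>k\<in>K. \<omega> (i, k)) \<in> measurable ?P (PiM K (M i))" if "i \<in> I" for i
    using that by (intro measurable_restrict) (auto intro: measurable_component_singleton[of "(i, _)" _ ?M, simplified])
  have "P.indep_vars (\<lambda>i. PiM K (M i)) (\<lambda>i \<omega>. \<lambda>k\<in>K. \<omega> (i, k)) I"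
  proof -
    have "P.indep_vars ?M (\<lambda>p \<omega>. \<omega> p) (I \<times> K)"
      using I K by (intro indep_vars_PiM_coords[where g = "\<lambda>p. p"] M') auto
    then have "P.indep_vars (\<lambda>i. PiM ({i} \<times> K) ?M) (\<lambda>i \<omega>. restrict (\<lambda>p. \<omega> p) ({i} \<times> K)) I"
      by (rule P.indep_vars_restrict) (auto simp: disjoint_family_on_def)
    from P.indep_vars_compose2[OF this rv] show ?thesis
      by (rule P.indep_vars_cong[THEN iffD1, OF refl _ refl, rotated]) (auto simp: fun_eq_iff)
  qed
  then have "distr ?P (\<Pi>\<^sub>M i\<in>I. \<Pi>\<^sub>M k\<in>K. M i k) (\<lambda>\<omega>. \<lambda>i\<in>I. \<lambda>k\<in>K. \<omega> (i, k)) =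
      (\<Pi>\<^sub>M i\<in>I. distr ?P (PiM K (M i)) (\<lambda>\<omega>. \<lambda>k\<in>K. \<omega> (i, k)))"
    by (subst (asm) P.indep_vars_iff_distr_eq_PiM'[OF I rvP])
  also have "\<dots> = (\<Pi>\<^sub>M i\<in>I. \<Pi>\<^sub>M k\<in>K. M i k)"
  proof (intro PiM_cong refl)
    fix i assume "i \<in> I"
    then show "distr ?P (PiM K (M i)) (\<lambda>\<omega>. \<lambda>k\<in>K. \<omega> (i, k)) = PiM K (M i)"
      using distr_PiM_reindex[of "I \<times> K" ?M "\<lambda>k. (i, k)" K] M' by (auto simp: inj_on_def)
  qed
  finally show ?thesis by simp
qed

text \<open>The sum is at most \<open>card A\<close> times its largest term, whose power is one of
  the summands on the right. This covers all \<open>a > 0\<close>, whereas convexity would require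
  \<open>a \<ge> 1\<close>.\<close>

lemma sum_powr_le:
  fixes f :: "'i \<Rightarrow> real"
  assumes "finite A" "\<And>i. i \<in> A \<Longrightarrow> f i \<ge> 0" "a > 0"
  shows "(\<Sum>i\<in>A. f i) powr a \<le> real (card A) powr a * (\<Sum>i\<in>A. f i powr a)"
proof (cases "A = {}")
  case False
  then have "Max (f ` A) \<in> f ` A" using assms(1) by (intro Max_in) auto
  then obtain k where k: "k \<in> A" "f k = Max (f ` A)" by auto
  then have "f i \<le> f k" if "i \<in> A" for i using that assms(1) by simp
  then have "(\<Sum>i\<in>A. f i) \<le> real (card A) * f k" by (rule sum_bounded_above)
  then have "(\<Sum>i\<in>A. f i) powr a \<le> (real (card A) * f k) powr a"
    using assms by (intro powr_mono2 sum_nonneg) auto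
  also have "\<dots> = real (card A) powr a * f k powr a"
    using assms(2)[OF k(1)] by (simp add: powr_mult)
  also have "\<dots> \<le> real (card A) powr a * (\<Sum>i\<in>A. f i powr a)"
    using member_le_sum[of k A "\<lambda>i. f i powr a"] k assms(1) by (intro mult_left_mono) auto
  finally show ?thesis .
qed simp

lemma random_placement_eq:
  assumes "n \<ge> 1" "d \<ge> 1"
  shows "random_placement d n =
    distr (uniform_product ({..<n} \<times> {..<d})) (\<Pi>\<^sub>M i\<in>{..<n}. uniform_product {..<d})
      (\<lambda>\<omega>. \<lambda>i\<in>{..<n}. \<lambda>k\<in>{..<d}. \<omega> (i, k))"
  using PiM_PiM_eq_distr[of "{..<n}" "{..<d}" "\<lambda>_ _. uniform_interval"] assms
  by (simp add: random_placement_def uniform_cube_eq prob_space_uniform_interval lessThan_empty_iff)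

section \<open>Measurability and expectation of the total movement\<close>

lemma measurable_random_placement_coord:
  "(\<lambda>x. x i l) \<in> borel_measurable (random_placement d n)"
proof (cases "i < n")
  case True
  have "(\<lambda>x. x i) \<in> measurable (random_placement d n) (uniform_product {..<d})"
    unfolding random_placement_def uniform_cube_eq using True by (intro measurable_component_singleton) simp
  then show ?thesis
    by (rule measurable_compose[OF _ measurable_uniform_product_coord])
next
  case False
  have "(\<lambda>x. x i l) \<in> borel_measurable (random_placement d n) \<longleftrightarrow>
      (\<lambda>x. (undefined :: point) l) \<in> borel_measurable (random_placement d n)"
    by (rule measurable_cong)
      (use False in \<open>auto simp: random_placement_def space_PiM PiE_def extensional_def\<close>)
  then show ?thesis by simp
qed

lemma measurable_total_movement:
  assumes "m \<ge> 1"
  shows "total_movement a d m y \<in> borel_measurable (random_placement d n)"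
proof -
  note [measurable] = measurable_random_placement_coord
  have [measurable]: "(\<lambda>x. anchor m y (target d m x r S i l)) \<in> borel_measurable (random_placement d n)" for r S i l
    by (rule measurable_compose[OF measurable_target]) auto
  have eq: "total_movement a d m y = (\<lambda>x. \<Sum>i<m ^ d.
      (\<Sum>l<d. \<bar>x i l - anchor m y (target d m x d [0..<m ^ d] i l)\<bar>) powr a)"
    by (simp add: total_movement_def displacement_eq[OF assms] fun_eq_iff)
  show ?thesis unfolding eq by measurable
qed

lemma total_movement_nonneg: "total_movement a d m y x \<ge> 0"
  by (simp add: total_movement_def sum_nonneg)

lemma total_movement_le_cost:
  assumes "m \<ge> 1" "a > 0"
  shows "total_movement a d m 1 x \<le> real d powr a * cost d m a d [0..<m ^ d] x"
proof -
  have "total_movement a d m 1 x \<le>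
      (\<Sum>i<m ^ d. real d powr a * (\<Sum>l<d. \<bar>x i l - anchor m 1 (target d m x d [0..<m ^ d] i l)\<bar> powr a))"
    unfolding total_movement_def
    using assms sum_powr_le[of "{..<d}" "\<lambda>l. \<bar>x i l - anchor m 1 (target d m x d [0..<m ^ d] i l)\<bar>" a for i]
    by (intro sum_mono) (simp add: displacement_eq)
  also have "\<dots> = real d powr a * cost d m a d [0..<m ^ d] x"
    by (simp add: cost_def sum_distrib_left atLeast0LessThan)
  finally show ?thesis .
qed

lemma nn_integral_total_movement_le:
  assumes "m \<ge> 1" "a > 0" "d \<ge> 1"
  shows "(\<integral>\<^sup>+x. ennreal (total_movement a d m 1 x) \<partial>random_placement d (m ^ d)) \<le>
    ennreal (real d powr a * (real d * real (m ^ d) * (tail_constant a * real m powr (- a / 2))))"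
proof -
  define n where "n = m ^ d"
  define curry where "curry = (\<lambda>\<omega> :: nat \<times> nat \<Rightarrow> real. \<lambda>i\<in>{..<n}. \<lambda>k\<in>{..<d}. \<omega> (i, k))"
  let ?P = "uniform_product ({..<n} \<times> {..<d})"
  have n: "n \<ge> 1" using assms by (simp add: n_def)
  have rp: "random_placement d n = distr ?P (random_placement d n) curry"
    using random_placement_eq[OF n assms(3)] unfolding curry_def
    by (subst random_placement_def) (simp add: uniform_cube_eq)
  have [measurable]: "curry \<in> measurable ?P (random_placement d n)"
    unfolding curry_def random_placement_def uniform_cube_eq
    by (intro measurable_restrict measurable_component_singleton) auto
  have [measurable]: "total_movement a d m 1 \<in> borel_measurable (random_placement d n)"
    by (rule measurable_total_movement[OF assms(1)])
  have [measurable]: "(\<lambda>\<omega>. cost d m a d [0..<n] (\<lambda>i l. \<omega> (i, l))) \<in> borel_measurable ?P"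
    by (intro measurable_cost measurable_uniform_product_coord)
  have "(\<integral>\<^sup>+x. ennreal (total_movement a d m 1 x) \<partial>random_placement d n) =
      (\<integral>\<^sup>+\<omega>. ennreal (total_movement a d m 1 (curry \<omega>)) \<partial>?P)"
    by (subst rp, subst nn_integral_distr) auto
  also have "\<dots> \<le> (\<integral>\<^sup>+\<omega>. ennreal (real d powr a) * ennreal (cost d m a d [0..<n] (\<lambda>i l. \<omega> (i, l))) \<partial>?P)"
  proof (intro nn_integral_mono)
    fix \<omega>
    \<comment> \<open>Currying changes \<open>\<omega>\<close> only outside the sensors and axes
      that the cost reads.\<close>
    have "cost d m a d [0..<n] (curry \<omega>) = cost d m a d [0..<n] (\<lambda>i l. \<omega> (i, l))"
      by (rule cost_cong) (auto simp: curry_def)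
    then have "total_movement a d m 1 (curry \<omega>) \<le> real d powr a * cost d m a d [0..<n] (\<lambda>i l. \<omega> (i, l))"
      using total_movement_le_cost[OF assms(1,2), of d "curry \<omega>"] by (simp add: n_def)
    then show "ennreal (total_movement a d m 1 (curry \<omega>)) \<le>
        ennreal (real d powr a) * ennreal (cost d m a d [0..<n] (\<lambda>i l. \<omega> (i, l)))"
      by (simp add: ennreal_leI flip: ennreal_mult')
  qed
  also have "\<dots> = ennreal (real d powr a) * (\<integral>\<^sup>+\<omega>. ennreal (cost d m a d [0..<n] (\<lambda>i l. \<omega> (i, l))) \<partial>?P)"
    by (intro nn_integral_cmult) measurable
  also have "\<dots> \<le> ennreal (real d powr a) *
      ennreal (real d * real (m ^ d) * (tail_constant a * real m powr (- a / 2)))"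
    using nn_integral_cost_le[of "{..<n}" m a d d "[0..<n]"] assms
    by (intro mult_left_mono) (auto simp: n_def atLeast0LessThan)
  finally show ?thesis by (simp add: n_def flip: ennreal_mult')
qed

theorem theorem3:
  fixes d :: nat and a :: real
  assumes "d \<ge> 1" and "a > 0"
  shows
    "(\<forall>m\<ge>1. \<forall>x \<in> (\<Pi>\<^sub>E i\<in>{..<m ^ d}. unit_cube d).
        bij_betw (final_position d m 1 x) {..<m ^ d} (grid d m) \<and>
        unit_cube d \<subseteq> (\<Union>i<m ^ d. sensing_cube d (1 / (2 * real m)) (final_position d m 1 x i))) \<and>
     (\<forall>m\<ge>1. integrable (random_placement d (m ^ d)) (total_movement a d m 1)) \<and>
     (\<lambda>m. integral\<^sup>L (random_placement d (m ^ d)) (total_movement a d m 1))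
       \<in> O(\<lambda>m. real (m ^ d) powr (1 - a / (2 * real d)))"
proof (intro conjI allI impI ballI)
  fix m :: nat and x
  assume m: "m \<ge> 1" and x: "x \<in> (\<Pi>\<^sub>E i\<in>{..<m ^ d}. unit_cube d)"
  show bij: "bij_betw (final_position d m 1 x) {..<m ^ d} (grid d m)"
    by (rule bij_betw_final_position[OF m x])
  have "(\<Union>i<m ^ d. sensing_cube d (1 / (2 * real m)) (final_position d m 1 x i)) =
      (\<Union>p\<in>grid d m. sensing_cube d (1 / (2 * real m)) p)"
    by (simp only: bij_betw_imp_surj_on[OF bij, symmetric] image_image)
  then show "unit_cube d \<subseteq> (\<Union>i<m ^ d. sensing_cube d (1 / (2 * real m)) (final_position d m 1 x i))"
    using unit_cube_covered_by_grid[OF m] by simp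
next
  fix m :: nat
  assume m: "m \<ge> 1"
  show "integrable (random_placement d (m ^ d)) (total_movement a d m 1)"
  proof (rule integrableI_nonneg)
    show "(\<integral>\<^sup>+x. ennreal (total_movement a d m 1 x) \<partial>random_placement d (m ^ d)) < \<infinity>"
      using nn_integral_total_movement_le[OF m assms(2,1)] by (rule le_less_trans) simp
  qed (simp_all add: measurable_total_movement[OF m] total_movement_nonneg)
next
  \<comment> \<open>\<open>C\<close> depends on \<open>d\<close> and \<open>a\<close> only, and the
    bound below holds for every \<open>m \<ge> 1\<close>, not just for large
    \<open>m\<close>.\<close>
  define C where "C = real d powr a * real d * tail_constant a"
  have C: "C \<ge> 0" using tail_constant_nonneg[OF assms(2)] by (simp add: C_def)
  have "norm (integral\<^sup>L (random_placement d (m ^ d)) (total_movement a d m 1))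
      \<le> C * norm (real (m ^ d) powr (1 - a / (2 * real d)))" if m: "m \<ge> 1" for m
  proof -
    let ?R = "random_placement d (m ^ d)"
    have "real d powr a * (real d * real (m ^ d) * (tail_constant a * real m powr (- a / 2)))
        = C * (real (m ^ d) * real m powr (- a / 2))"
      by (simp add: C_def)
    also have "real (m ^ d) * real m powr (- a / 2) = real (m ^ d) powr (1 - a / (2 * real d))"
    proof -
      have "real (m ^ d) powr (- (a / (2 * real d))) = real m powr (- a / 2)"
        using m assms(1) by (simp add: powr_realpow[symmetric] powr_powr)
      then show ?thesis using m by (simp add: powr_diff powr_minus field_simps)
    qed
    finally have bound: "(\<integral>\<^sup>+x. ennreal (total_movement a d m 1 x) \<partial>?R)
        \<le> ennreal (C * real (m ^ d) powr (1 - a / (2 * real d)))"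
      using nn_integral_total_movement_le[OF m assms(2,1)] by simp
    have "integral\<^sup>L ?R (total_movement a d m 1) = enn2real (\<integral>\<^sup>+x. ennreal (total_movement a d m 1 x) \<partial>?R)"
      by (intro integral_eq_nn_integral measurable_total_movement[OF m]) (simp add: total_movement_nonneg)
    also have "\<dots> \<le> C * real (m ^ d) powr (1 - a / (2 * real d))"
      using bound C by (intro enn2real_leI) auto
    finally show ?thesis
      by (simp add: integral_nonneg total_movement_nonneg)
  qed
  then show "(\<lambda>m. integral\<^sup>L (random_placement d (m ^ d)) (total_movement a d m 1))
       \<in> O(\<lambda>m. real (m ^ d) powr (1 - a / (2 * real d)))"
    by (intro bigoI[of _ C] eventually_sequentiallyI[of 1]) auto
qed

end
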